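(* Let $\Omega$ be a metrizable locally compact space and let $p\in\partial^{(\infty)}(\Omega^\flat)$. Then there exists a well-ordered decreasing chain $(\mathcal{Q}_\alpha:\alpha\in\mathfrak{c})$ of prime $z$-filters on $\Omega$, each supported at $p$. Furthermore, (for this chain) by setting $Q_\alpha=C_0(\Omega)\cap\mathbf{Z}^{-1}[\mathcal{Q}_\alpha]$ one obtains a well-ordered decreasing chain $(Q_\alpha:\alpha\in\mathfrak{c})$ of prime $z$-ideals in $C_0(\Omega)$, each supported at $p$.
   Context: Topological spaces are Hausdorff. $\mathfrak{c}=2^{\aleph_0}$, identified with the smallest ordinal of that cardinality. A well-ordered decreasing chain indexed by an ordinal $\kappa$ means a family with $\mathcal{Q}_\beta\subsetneq\mathcal{Q}_\alpha$ whenever $\alpha<\beta$ in $\kappa$. $\Omega^\flat$ is the one-point compactification of $\Omega$ (the added point is "the point at infinity"). $C(\Omega)$ is the algebra of continuous scalar-valued functions on $\Omega$ and $C_0(\Omega)$ the subalgebra of those vanishing at infinity (scalar field real or complex, fixed). For a compact space $K$, $\partial^{(1)}K=\partial K$ is the set of all limit points of $K$, $\partial^{(n+1)}K=\partial(\partial^{(n)}K)$ for $n\ge1$, and $\partial^{(\infty)}K=\bigcap_{n\ge1}\partial^{(n)}K$. $\mathbf{Z}(f)=f^{-1}(0)$ and $\mathbf{Z}[\Omega]=\{\mathbf{Z}(f):f\in C(\Omega)\}$. A $z$-filter on $\Omega$ is a non-empty proper subset of $\mathbf{Z}[\Omega]$ closed under finite intersections and under supersets belonging to $\mathbf{Z}[\Omega]$.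 A $z$-filter $\mathcal{P}$ is prime if $Z_1\cup Z_2\notin\mathcal{P}$ whenever $Z_1,Z_2\in\mathbf{Z}[\Omega]\setminus\mathcal{P}$. For a $z$-filter $\mathcal{F}$, $\mathbf{Z}^{-1}[\mathcal{F}]=\{f\in C(\Omega):\mathbf{Z}(f)\in\mathcal{F}\}$. An ideal $I$ of $C_0(\Omega)$ is a $z$-ideal if $g\in I$ whenever $g\in C_0(\Omega)$, $f\in I$ and $\mathbf{Z}(g)\supset\mathbf{Z}(f)$. Prime ideals are proper. A prime $z$-filter $\mathcal{P}$ is supported at $p\in\Omega$ if $p\in Z$ for all $Z\in\mathcal{P}$, and supported at the point at infinity if no such $p\in\Omega$ exists. A prime ideal $P$ of $C_0(\Omega)$ is supported at $p\in\Omega$ if $f(p)=0$ for all $f\in P$, and supported at infinity if no such $p\in\Omega$ exists. *)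

theory Defs
  imports "HOL-Analysis.Analysis"
begin

definition limit_points :: "'a topology \<Rightarrow> 'a set" where
  "limit_points K = K derived_set_of (topspace K)"

(* Each iterate is regarded as a space in its own right, with the topology of K. *)
primrec iterated_limit_points :: "'a topology \<Rightarrow> nat \<Rightarrow> 'a set" where
  "iterated_limit_points K 0 = topspace K"
| "iterated_limit_points K (Suc n) = limit_points (subtopology K (iterated_limit_points K n))"

definition limit_points_infinity :: "'a topology \<Rightarrow> 'a set" where
  "limit_points_infinity K = (\<Inter>n\<in>{1..}. iterated_limit_points K n)"

(* The intended scalar fields have sort {real_normed_field, euclidean_space}: real and complex are
   instances, and up to isomorphism there are no others.  The definitions need less. *)
definition continuous_functions :: "('a::topological_space \<Rightarrow> 'k::real_normed_field) set" where
  "continuous_functions = {f. continuous_on UNIV f}"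

definition C0_functions :: "('a::topological_space \<Rightarrow> 'k::real_normed_field) set" where
  "C0_functions =
     {f \<in> continuous_functions. \<forall>\<epsilon>>0. compact {x. \<epsilon> \<le> norm (f x)}}"

definition zero_set :: "('a \<Rightarrow> 'k::zero) \<Rightarrow> 'a set" where
  "zero_set f = f -` {0}"

(* The type argument is the scalar field. *)
definition zero_sets :: "'k::real_normed_field itself \<Rightarrow> 'a::topological_space set set" where
  "zero_sets (_ :: 'k itself) =
     zero_set ` (continuous_functions :: ('a \<Rightarrow> 'k) set)"

definition z_filter :: "'k::real_normed_field itself \<Rightarrow> 'a::topological_space set set \<Rightarrow> bool" where
  "z_filter K F \<longleftrightarrow>
     F \<noteq> {} \<and> F \<subset> zero_sets K \<and>
     (\<forall>Y\<in>F. \<forall>Z\<in>F. Y \<inter> Z \<in> F) \<and>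
     (\<forall>Y\<in>F. \<forall>Z\<in>zero_sets K. Y \<subseteq> Z \<longrightarrow> Z \<in> F)"

definition prime_z_filter :: "'k::real_normed_field itself \<Rightarrow> 'a::topological_space set set \<Rightarrow> bool" where
  "prime_z_filter K P \<longleftrightarrow>
     z_filter K P \<and>
     (\<forall>Y\<in>zero_sets K - P. \<forall>Z\<in>zero_sets K - P. Y \<union> Z \<notin> P)"

definition inverse_zero :: "'a::topological_space set set \<Rightarrow> ('a \<Rightarrow> 'k::real_normed_field) set" where
  "inverse_zero F = {f \<in> continuous_functions. zero_set f \<in> F}"

(* The ideals of HOL-Algebra live in unital rings, but C0_functions has no unit unless the
   space is compact.  As usual for algebras, an ideal is required to be a linear subspace. *)
definition C0_ideal :: "('a::topological_space \<Rightarrow> 'k::real_normed_field) set \<Rightarrow> bool" where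
  "C0_ideal I \<longleftrightarrow>
     I \<subseteq> C0_functions \<and> (\<lambda>x. 0) \<in> I \<and>
     (\<forall>f\<in>I. \<forall>g\<in>I. (\<lambda>x. f x + g x) \<in> I) \<and>
     (\<forall>c. \<forall>f\<in>I. (\<lambda>x. c * f x) \<in> I) \<and>
     (\<forall>g\<in>C0_functions. \<forall>f\<in>I. (\<lambda>x. g x * f x) \<in> I)"

definition C0_prime_ideal :: "('a::topological_space \<Rightarrow> 'k::real_normed_field) set \<Rightarrow> bool" where
  "C0_prime_ideal P \<longleftrightarrow>
     C0_ideal P \<and> P \<noteq> C0_functions \<and>
     (\<forall>f\<in>C0_functions. \<forall>g\<in>C0_functions. (\<lambda>x. f x * g x) \<in> P \<longrightarrow> f \<in> P \<or> g \<in> P)"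

definition C0_z_ideal :: "('a::topological_space \<Rightarrow> 'k::real_normed_field) set \<Rightarrow> bool" where
  "C0_z_ideal I \<longleftrightarrow>
     C0_ideal I \<and>
     (\<forall>g\<in>C0_functions. \<forall>f\<in>I. zero_set f \<subseteq> zero_set g \<longrightarrow> g \<in> I)"

(* Points of the one-point compactification are Some x for x in the space, and None for the
   point at infinity, as in Alexandroff_compactification. *)
definition filter_supported_at :: "'a set set \<Rightarrow> 'a option \<Rightarrow> bool" where
  "filter_supported_at P p \<longleftrightarrow>
     (case p of
        Some x \<Rightarrow> \<forall>Z\<in>P. x \<in> Z
      | None \<Rightarrow> \<not> (\<exists>x. \<forall>Z\<in>P. x \<in> Z))"

definition ideal_supported_at :: "('a \<Rightarrow> 'k::zero) set \<Rightarrow> 'a option \<Rightarrow> bool" where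
  "ideal_supported_at P p \<longleftrightarrow>
     (case p of
        Some x \<Rightarrow> \<forall>f\<in>P. f x = 0
      | None \<Rightarrow> \<not> (\<exists>x. \<forall>f\<in>P. f x = 0))"

(* card_of A is a well-order of A of minimal order type, i.e. an initial ordinal; the ordinals
   below it correspond to the elements of its field.  Here A consists of all functions nat => bool,
   so the cardinality is two to the power aleph-zero. *)
definition continuum :: "(nat \<Rightarrow> bool) rel" where
  "continuum = card_of UNIV"

(* The order r is reflexive, so the strict order is obtained by excluding equality. *)
definition decreasing_chain :: "'i rel \<Rightarrow> ('i \<Rightarrow> 'b set) \<Rightarrow> bool" where
  "decreasing_chain r Q \<longleftrightarrow>
     Well_order r \<and> (\<forall>\<alpha> \<beta>. (\<alpha>, \<beta>) \<in> r \<and> \<alpha> \<noteq> \<beta> \<longrightarrow> Q \<beta> \<subset> Q \<alpha>)"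

end

theory Submission
  imports Defs
begin

text \<open>In a metric space the zero sets are the closed sets, and every ultrafilter yields a prime filter
  of closed sets. Choose points \<open>x i\<close> tending to \<open>p\<close> in disjoint compact balls, with \<open>x i\<close> in the
  \<open>b i\<close>-th iterated limit set, and below each \<open>x i\<close> closed layers \<open>F i 0 \<subseteq> \<dots> \<subseteq> F i (b i)\<close> such that
  every point of a layer is a limit of points newly added in the next one. A function \<open>h \<alpha>\<close> bounded by
  \<open>b\<close> determines the closed set formed by the layers \<open>F i (h \<alpha> i)\<close> (and \<open>p\<close>). There are continuum many
  functions \<open>h \<alpha>\<close> that simultaneously take prescribed values on any finite set of \<open>\<alpha>\<close> at infinitely
  many \<open>i\<close>; hence, whatever the order of the indices \<open>\<alpha>\<close>, any finite part of the desired chain can be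
  approximated by points moving away from some \<open>x i\<close> through its layers. A limit of these points along
  an ultrafilter gives the whole chain.\<close>

section \<open>Two applications of Zorn's lemma: ultrafilters and maximal separated sets\<close>

text \<open>Zorn's lemma is applied to the proper filters below \<open>F\<close> in reversed order,
  so the maximal element is a minimal proper filter. A nonempty chain of proper filters is a base of
  its infimum, which therefore stays proper.\<close>

lemma ultrafilter_exists:
  fixes F :: "'a filter"
  assumes "F \<noteq> bot"
  obtains U where "U \<le> F" "U \<noteq> bot" "\<And>P. eventually P U \<or> eventually (\<lambda>x. \<not> P x) U"
proof -
  let ?A = "{G. G \<le> F \<and> G \<noteq> bot}"
  let ?r = "relation_of (\<lambda>G H. H \<le> G) ?A"
  have "\<exists>m\<in>?A. \<forall>a\<in>?A. a \<le> m \<longrightarrow> a = m"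
  proof (rule predicate_Zorn)
    show "partial_order_on ?A ?r"
      by (rule partial_order_on_relation_ofI) auto
    fix C assume C: "C \<in> Chains ?r"
    then have sub: "C \<subseteq> ?A" and lin: "\<And>G H. G \<in> C \<Longrightarrow> H \<in> C \<Longrightarrow> G \<le> H \<or> H \<le> G"
      by (auto simp: Chains_def relation_of_def)
    show "\<exists>u\<in>?A. \<forall>a\<in>C. u \<le> a"
    proof (cases "C = {}")
      case True
      with assms show ?thesis by auto
    next
      case False
      have "eventually (\<lambda>x. False) (Inf C) \<longleftrightarrow> (\<exists>b\<in>C. eventually (\<lambda>x. False) b)"
      proof (rule eventually_Inf_base[OF False])
        fix G H assume "G \<in> C" "H \<in> C"
        with lin[of G H] show "\<exists>x\<in>C. x \<le> inf G H" by (auto simp: inf_absorb1 inf_absorb2)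
      qed
      then have "Inf C \<noteq> bot"
        using sub unfolding eventually_False by blast
      moreover have "Inf C \<le> F"
        using False sub by (blast intro: Inf_lower2)
      ultimately show ?thesis by (blast intro: Inf_lower)
    qed
  qed
  then obtain m where m: "m \<le> F" "m \<noteq> bot" and max: "\<And>a. a \<le> F \<Longrightarrow> a \<noteq> bot \<Longrightarrow> a \<le> m \<Longrightarrow> a = m"
    by auto
  have "eventually P m \<or> eventually (\<lambda>x. \<not> P x) m" for P
  proof (rule disjCI)
    assume *: "\<not> eventually (\<lambda>x. \<not> P x) m"
    \<comment> \<open>Unless \<open>m\<close> already contains the negation of \<open>P\<close>,
      restricting \<open>m\<close> to \<open>P\<close> gives a proper filter, and minimality makes
      it equal to \<open>m\<close>.\<close>
    have "inf m (principal {x. P x}) \<noteq> bot"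
      using * by (simp flip: eventually_False add: eventually_inf_principal)
    with m max[of "inf m (principal {x. P x})"] have "inf m (principal {x. P x}) = m"
      by (meson inf_le1 order_trans)
    moreover have "eventually P (inf m (principal {x. P x}))"
      by (simp add: eventually_inf_principal)
    ultimately show "eventually P m" by simp
  qed
  with m show thesis by (rule that)
qed

text \<open>A pairwise condition passes to unions of chains, so Zorn's lemma applies. As
  \<open>R\<close> may be asymmetric, a point outside \<open>D\<close> conflicts with some
  \<open>d\<close> in at least one of the two directions.\<close>

lemma maximal_pairwise_subset:
  obtains D where "D \<subseteq> X" "pairwise R D"
    "\<And>y. y \<in> X \<Longrightarrow> y \<notin> D \<Longrightarrow> \<exists>d\<in>D. \<not> (R d y \<and> R y d)"
proof -
  let ?A = "{D. D \<subseteq> X \<and> pairwise R D}"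
  have "\<exists>M\<in>?A. \<forall>D\<in>?A. M \<subseteq> D \<longrightarrow> D = M"
  proof (rule subset_Zorn_nonempty)
    show "?A \<noteq> {}" by (auto intro!: exI[of _ "{}"])
    fix \<C> assume "\<C> \<noteq> {}" and \<C>: "subset.chain ?A \<C>"
    then have "pairwise R (\<Union>\<C>)"
      by (intro pairwise_chain_Union) (auto simp: subset_chain_def chain_subset_def)
    then show "\<Union>\<C> \<in> ?A"
      using \<C> by (auto simp: subset.chain_def)
  qed
  then obtain M where M: "M \<subseteq> X" "pairwise R M"
    and max: "\<And>D. D \<subseteq> X \<Longrightarrow> pairwise R D \<Longrightarrow> M \<subseteq> D \<Longrightarrow> D = M"
    by auto
  have "\<exists>d\<in>M. \<not> (R d y \<and> R y d)" if "y \<in> X" "y \<notin> M" for y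
    using M that max[of "insert y M"] by (auto simp: pairwise_insert)
  with M show thesis by (rule that)
qed

section \<open>Layers below iterated limit points\<close>

text \<open>The separation required of two points of \<open>D\<close> is proportional to their distance from \<open>F\<close>,
  so a maximal such \<open>D\<close> can accumulate only on \<open>F\<close>, and by maximality it does so everywhere.\<close>
lemma set_with_prescribed_limit_points:
  fixes F :: "'a::metric_space set"
  assumes "closed F" and F: "F \<subseteq> closure (Y - F)"
  obtains D where "D \<subseteq> Y - F" "F \<subseteq> closure D" "\<And>z. z islimpt D \<Longrightarrow> z \<in> F"
proof (cases "F = {}")
  case True
  then show thesis using that[of "{}"] by auto
next
  case ne: False
  let ?R = "\<lambda>d d'. max (infdist d F) (infdist d' F) \<le> 2 * dist d d'"
  obtain D where D: "D \<subseteq> Y - F" and R: "pairwise ?R D"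
    and max: "\<And>y. y \<in> Y - F \<Longrightarrow> y \<notin> D \<Longrightarrow> \<exists>d\<in>D. \<not> (?R d y \<and> ?R y d)"
    by (rule maximal_pairwise_subset[of "Y - F" ?R], rule that)
  have "F \<subseteq> closure D"
  proof
    fix e assume e: "e \<in> F"
    show "e \<in> closure D"
      unfolding closure_approachable
    proof safe
      fix \<epsilon> :: real assume "\<epsilon> > 0"
      moreover have "e \<in> closure (Y - F)" using e F by blast
      ultimately obtain y where y: "y \<in> Y - F" "dist y e < \<epsilon> / 2"
        unfolding closure_approachable by (meson half_gt_zero)
      show "\<exists>d\<in>D. dist d e < \<epsilon>"
      proof (cases "y \<in> D")
        case True
        with y \<open>\<epsilon> > 0\<close> show ?thesis by (intro bexI[of _ y]) auto
      next
        case False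
        then obtain d where d: "d \<in> D" and "\<not> (?R d y \<and> ?R y d)" using max y by blast
        then have nR: "2 * dist d y < max (infdist d F) (infdist y F)"
          by (auto simp: dist_commute max.commute)
        \<comment> \<open>Whichever distance is the larger in \<open>nR\<close>, the triangle
          inequality gives \<open>dist d y < infdist y F\<close>, which is at most
          \<open>dist y e\<close>. Thus \<open>d\<close> is less than twice \<open>dist y e\<close>
          away from \<open>e\<close>.\<close>
        have "infdist y F \<le> dist y e" using e by (rule infdist_le)
        moreover have "infdist d F \<le> infdist y F + dist d y" by (rule infdist_triangle)
        moreover have "dist d e \<le> dist d y + dist y e" by (rule dist_triangle)
        ultimately have "dist d e < \<epsilon>" using nR y zero_le_dist[of y e] unfolding max_def by (smt (verit) field_sum_of_halves)
        with d show ?thesis ..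
      qed
    qed
  qed
  moreover have "z \<in> F" if z: "z islimpt D" for z
  proof (rule ccontr)
    assume "z \<notin> F"
    then have pos: "infdist z F > 0"
      using \<open>closed F\<close> ne by (simp add: infdist_pos_not_in_closed)
    \<comment> \<open>Let \<delta> be \<open>infdist z F\<close>. Two points of \<open>D\<close>
      within \<delta>/8 of \<open>z\<close> are less than \<delta>/4 apart, yet separation demands
      at least 7\<delta>/16, since \<open>infdist d F\<close> is at least 7\<delta>/8. Taking
      \<open>d'\<close> closer to \<open>z\<close> than \<open>d\<close> ensures that they
      differ.\<close>
    obtain d where d: "d \<in> D" "d \<noteq> z" "dist d z < infdist z F / 8"
      using z pos unfolding islimpt_approachable by (meson divide_pos_pos zero_less_numeral)
    obtain d' where d': "d' \<in> D" "d' \<noteq> z" "dist d' z < dist d z"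
      using z d unfolding islimpt_approachable by (meson zero_less_dist_iff)
    have "d \<noteq> d'" using d' by auto
    with R d d' have "infdist d F \<le> 2 * dist d d'" by (auto simp: pairwise_def)
    moreover have "dist d d' \<le> dist d z + dist d' z" by (rule dist_triangle2)
    moreover have "infdist z F \<le> infdist d F + dist z d" by (rule infdist_triangle)
    ultimately show False using d d' pos by (simp add: dist_commute)
  qed
  ultimately show thesis using D that by blast
qed

text \<open>Translates relatively open sets of the iterate into open sets of the whole space, which
  makes the theory of \<open>islimpt\<close> available in place of the defining recursion.\<close>

lemma iterated_limit_points_euclidean_Suc:
  "x \<in> iterated_limit_points euclidean (Suc n) \<longleftrightarrow>
   x \<in> iterated_limit_points euclidean n \<and> x islimpt iterated_limit_points euclidean n"
proof -
  let ?S = "iterated_limit_points euclidean n :: 'a set"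
  have "x \<in> iterated_limit_points euclidean (Suc n) \<longleftrightarrow>
    x \<in> ?S \<and> (\<forall>T. (\<exists>U. open U \<and> T = U \<inter> ?S) \<longrightarrow> x \<in> T \<longrightarrow> (\<exists>y\<in>?S. y \<noteq> x \<and> y \<in> T))"
    by (simp add: limit_points_def in_derived_set_of openin_subtopology) metis
  then show ?thesis
    unfolding islimpt_def by blast
qed

declare iterated_limit_points.simps(2) [simp del]

lemma closed_iterated_limit_points: "closed (iterated_limit_points euclidean n :: 'a::metric_space set)"
proof (induction n)
  case 0
  then show ?case by simp
next
  case (Suc n)
  have "closed {x. x islimpt (iterated_limit_points euclidean n :: 'a set)}"
    by (rule closed_limpts)
  with Suc have "closed (iterated_limit_points euclidean n \<inter> {x :: 'a. x islimpt iterated_limit_points euclidean n})"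
    by blast
  moreover have "iterated_limit_points euclidean (Suc n)
    = iterated_limit_points euclidean n \<inter> {x :: 'a. x islimpt iterated_limit_points euclidean n}"
    using iterated_limit_points_euclidean_Suc by blast
  ultimately show ?case by simp
qed

lemma iterated_limit_points_antimono:
  assumes "m \<le> n"
  shows "iterated_limit_points euclidean n \<subseteq> iterated_limit_points euclidean m"
  using assms by (induction rule: dec_induct) (auto simp: iterated_limit_points_euclidean_Suc)

section \<open>Continuum many independent functions with a common bound\<close>

text \<open>An index \<open>i\<close> codes a length and a finite table assigning numbers to bit
  strings; \<open>h \<alpha> i\<close> looks up the prefix of \<alpha> of that length. Long prefixes
  tell the members of a finite \<open>A\<close> apart, so some table prescribes their values freely.
  This is the classical construction of independent families on a countable set.\<close>

lemma independent_functions: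
  obtains h :: "(nat \<Rightarrow> bool) \<Rightarrow> nat \<Rightarrow> nat" and b :: "nat \<Rightarrow> nat"
  where "\<And>\<alpha> i. h \<alpha> i \<le> b i"
    and "\<And>A g. finite A \<Longrightarrow> infinite {i. \<forall>\<alpha>\<in>A. h \<alpha> i = g \<alpha>}"
proof -
  define dec :: "nat \<Rightarrow> nat \<times> (bool list \<times> nat) list" where "dec = from_nat"
  \<comment> \<open>The default 0 for a missing prefix respects every bound.\<close>
  define h where "h \<alpha> i = (case map_of (snd (dec i)) (map \<alpha> [0..<fst (dec i)]) of None \<Rightarrow> 0 | Some v \<Rightarrow> v)"
    for \<alpha> :: "nat \<Rightarrow> bool" and i
  \<comment> \<open>The sum of all table entries bounds each of them independently of \<alpha>; the
    depth of the limit point chosen for \<open>i\<close> has to be fixed before \<alpha>.\<close>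
  define b where "b i = sum_list (map snd (snd (dec i)))" for i
  have "h \<alpha> i \<le> b i" for \<alpha> i
    by (force simp: h_def b_def split: option.split dest!: map_of_SomeD intro!: member_le_sum_list)
  moreover have "infinite {i. \<forall>\<alpha>\<in>A. h \<alpha> i = g \<alpha>}" if "finite A" for A :: "(nat \<Rightarrow> bool) set" and g
  proof -
    have "\<exists>N. \<forall>m\<ge>N. inj_on (\<lambda>\<alpha>. map \<alpha> [0..<m]) A"
    proof -
      have "\<forall>\<^sub>F m in sequentially. \<alpha> = \<beta> \<or> map \<alpha> [0..<m] \<noteq> map \<beta> [0..<m]" for \<alpha> \<beta> :: "nat \<Rightarrow> bool"
      proof (cases "\<alpha> = \<beta>")
        case False
        then obtain k where "\<alpha> k \<noteq> \<beta> k" by auto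
        then show ?thesis by (intro eventually_sequentiallyI[of "Suc k"]) auto
      qed simp
      then have "\<forall>\<^sub>F m in sequentially. \<forall>\<alpha>\<in>A. \<forall>\<beta>\<in>A. \<alpha> = \<beta> \<or> map \<alpha> [0..<m] \<noteq> map \<beta> [0..<m]"
        using \<open>finite A\<close> by (auto intro!: eventually_ball_finite)
      then show ?thesis unfolding eventually_sequentially inj_on_def by meson
    qed
    then obtain N where N: "\<And>m. m \<ge> N \<Longrightarrow> inj_on (\<lambda>\<alpha>. map \<alpha> [0..<m]) A" by blast
    obtain xs where xs: "set xs = A" "distinct xs" using \<open>finite A\<close> finite_distinct_list by blast
    \<comment> \<open>One suitable index for each large \<open>m\<close>; the length is part of the
      code, so these indices are distinct and hence infinitely many.\<close>
    define c where "c m = to_nat (m, map (\<lambda>\<alpha>. (map \<alpha> [0..<m], g \<alpha>)) xs)" for m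
    have "h \<alpha> (c m) = g \<alpha>" if "m \<ge> N" "\<alpha> \<in> A" for m \<alpha>
    proof -
      have "distinct (map fst (map (\<lambda>\<alpha>. (map \<alpha> [0..<m], g \<alpha>)) xs))"
        using N[OF that(1)] xs by (simp add: distinct_map o_def)
      then have "map_of (map (\<lambda>\<alpha>. (map \<alpha> [0..<m], g \<alpha>)) xs) (map \<alpha> [0..<m]) = Some (g \<alpha>)"
        by (rule map_of_is_SomeI) (use xs that in auto)
      then show ?thesis by (simp add: h_def c_def dec_def)
    qed
    then have "c ` {N..} \<subseteq> {i. \<forall>\<alpha>\<in>A. h \<alpha> i = g \<alpha>}" by auto
    moreover have "inj_on c {N..}" by (auto simp: c_def inj_on_def)
    then have "infinite (c ` {N..})" by (simp add: finite_image_iff infinite_Ici)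
    ultimately show ?thesis using finite_subset by blast
  qed
  ultimately show thesis by (rule that)
qed


section \<open>Closed layers around a point and sequences moving through them\<close>

text \<open>The layers grow outward from \<open>x\<close>, and layer \<open>j\<close> stays inside
  iterate \<open>n - j\<close>. Each step spends one order of limit: its points are limits of the
  next lower iterate, from which a set accumulating exactly on the current layer is added.\<close>

lemma layers_exist:
  fixes x :: "'a::metric_space"
  assumes x: "x \<in> iterated_limit_points euclidean n" and "r > 0"
  obtains F where "F 0 = {x}" "\<And>j. j \<le> n \<Longrightarrow> closed (F j)" "\<And>j. j \<le> n \<Longrightarrow> F j \<subseteq> ball x r"
    "\<And>j. j < n \<Longrightarrow> F j \<subseteq> F (Suc j)" "\<And>j. j < n \<Longrightarrow> F j \<subseteq> closure (F (Suc j) - F j)"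
proof -
  define Y where "Y m = iterated_limit_points euclidean m \<inter> ball x r" for m
  have lim: "z islimpt Y m" if "z \<in> Y (Suc m)" for z m
  proof -
    have "z islimpt iterated_limit_points euclidean m" "z \<in> ball x r"
      using that by (auto simp: Y_def iterated_limit_points_euclidean_Suc)
    then show ?thesis
      unfolding Y_def by (intro islimpt_Int_eventually eventually_at_in_open') auto
  qed
  have mono: "Y (Suc m) \<subseteq> Y m" for m
    by (auto simp: Y_def iterated_limit_points_euclidean_Suc)
  \<comment> \<open>The last conjunct is what the next extension step needs. The guards make the
    conditions void beyond \<open>n\<close>, because the recursive choice runs over all natural
    numbers.\<close>
  define P where "P j F \<longleftrightarrow> (j = 0 \<longrightarrow> F = {x}) \<and>
    (j \<le> n \<longrightarrow> closed F \<and> F \<subseteq> Y (n - j) \<and> (j < n \<longrightarrow> F \<subseteq> closure (Y (n - Suc j) - F)))" for j F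
  define Q where "Q j F G \<longleftrightarrow> (j < n \<longrightarrow> F \<subseteq> G \<and> F \<subseteq> closure (G - F))" for j and F G :: "'a set"
  have xY: "x \<in> Y n" using x \<open>r > 0\<close> by (simp add: Y_def)
  have "\<exists>F. \<forall>j. P j (F j) \<and> Q j (F j) (F (Suc j))"
  proof (rule dependent_nat_choice)
    have "x \<in> closure (Y (n - 1) - {x})" if "n > 0"
      using that xY lim[of x "n - 1"] by (simp add: islimpt_in_closure)
    then show "\<exists>F. P 0 F" using xY by (auto simp: P_def)
  next
    fix F j assume P: "P j F"
    show "\<exists>G. P (Suc j) G \<and> Q j F G"
    proof (cases "j < n")
      case False
      then show ?thesis by (auto simp: P_def Q_def)
    next
      case True
      then have "closed F" and FY: "F \<subseteq> Y (n - j)" "F \<subseteq> closure (Y (n - Suc j) - F)"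
        using P by (auto simp: P_def)
      then obtain D where D: "D \<subseteq> Y (n - Suc j) - F" "F \<subseteq> closure D" and Dlim: "\<And>z. z islimpt D \<Longrightarrow> z \<in> F"
        using set_with_prescribed_limit_points by blast
      let ?G = "F \<union> D"
      \<comment> \<open>Since all accumulation takes place on \<open>F\<close>, the new layer is
        closed and the points of \<open>D\<close> are isolated in it.\<close>
      have Glim: "z \<in> F" if "z islimpt ?G" for z
        using that Dlim \<open>closed F\<close> by (auto simp: islimpt_Un closed_limpt)
      have "closed ?G" using Glim by (auto simp: closed_limpt)
      moreover have "?G \<subseteq> Y (n - Suc j)"
        using D FY mono[of "n - Suc j"] True by (auto simp: Suc_diff_Suc)
      \<comment> \<open>A point of \<open>D\<close> is a limit of the lower iterate but not of
        \<open>?G\<close>, hence a limit of the difference. The points of \<open>F\<close> follow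
        because they lie in the closure of \<open>D\<close>.\<close>
      moreover have "?G \<subseteq> closure (Y (n - Suc (Suc j)) - ?G)" if "Suc j < n"
      proof -
        let ?Y = "Y (n - Suc (Suc j))"
        have "D \<subseteq> closure (?Y - ?G)"
        proof
          fix d assume "d \<in> D"
          with D have d: "d \<in> Y (Suc (n - Suc (Suc j)))" "d \<notin> F"
            using that by (auto simp: Suc_diff_Suc)
          have "d islimpt (?Y - ?G) \<union> ?G"
            by (rule islimpt_subset[OF lim[OF d(1)]]) blast
          then have "d islimpt (?Y - ?G)" using d Glim islimpt_Un by blast
          then show "d \<in> closure (?Y - ?G)" by (simp add: closure_def)
        qed
        moreover from this have "closure D \<subseteq> closure (?Y - ?G)" by (simp add: closure_minimal)
        ultimately show ?thesis using D by blast
      qed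
      moreover have "F \<subseteq> closure (?G - F)"
      proof -
        have "?G - F = D" using D by blast
        with D show ?thesis by simp
      qed
      ultimately have "P (Suc j) ?G \<and> Q j F ?G" by (auto simp: P_def Q_def)
      then show ?thesis ..
    qed
  qed
  then obtain F where F: "\<And>j. P j (F j)" "\<And>j. Q j (F j) (F (Suc j))" by blast
  show thesis
  proof (rule that)
    show "F j \<subseteq> ball x r" if "j \<le> n" for j
      using F(1)[of j] that by (auto simp: P_def Y_def)
  qed (use F in \<open>auto simp: P_def Q_def\<close>)
qed

text \<open>The next point is taken from the new part of the next layer, so close to
  \<open>z j\<close> that it avoids every member of \<open>\<Z>\<close> missing \<open>z j\<close>.
  Finiteness of \<open>\<Z>\<close> makes this an open condition.\<close>

lemma specializing_sequence:
  fixes F :: "nat \<Rightarrow> 'a::topological_space set"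
  assumes "finite \<Z>" and closed: "\<And>Z. Z \<in> \<Z> \<Longrightarrow> closed Z" and "F 0 = {x}"
    and F: "\<And>j. j < n \<Longrightarrow> F j \<subseteq> closure (F (Suc j) - F j)"
  obtains z where "\<And>j. j \<le> n \<Longrightarrow> z j \<in> F j" "\<And>j. j < n \<Longrightarrow> z (Suc j) \<notin> F j"
    "\<And>i j Z. i \<le> j \<Longrightarrow> j \<le> n \<Longrightarrow> Z \<in> \<Z> \<Longrightarrow> z j \<in> Z \<Longrightarrow> z i \<in> Z"
proof -
  have "\<exists>z. \<forall>j. (j \<le> n \<longrightarrow> z j \<in> F j) \<and>
    (j < n \<longrightarrow> z (Suc j) \<notin> F j \<and> (\<forall>Z\<in>\<Z>. z (Suc j) \<in> Z \<longrightarrow> z j \<in> Z))"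
  proof (rule dependent_nat_choice)
    show "\<exists>z. 0 \<le> n \<longrightarrow> z \<in> F 0" using \<open>F 0 = {x}\<close> by blast
  next
    fix z j assume z: "j \<le> n \<longrightarrow> z \<in> F j"
    show "\<exists>y. (Suc j \<le> n \<longrightarrow> y \<in> F (Suc j)) \<and>
      (j < n \<longrightarrow> y \<notin> F j \<and> (\<forall>Z\<in>\<Z>. y \<in> Z \<longrightarrow> z \<in> Z))"
    proof (cases "j < n")
      case True
      let ?U = "- \<Union>{Z \<in> \<Z>. z \<notin> Z}"
      have "closed (\<Union>{Z \<in> \<Z>. z \<notin> Z})" using \<open>finite \<Z>\<close> closed by (intro closed_Union) auto
      then have "open ?U" by (rule open_Compl)
      moreover have "z \<in> closure (F (Suc j) - F j)" using F[OF True] z True by auto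
      then have "?U \<inter> closure (F (Suc j) - F j) \<noteq> {}" by blast
      ultimately have "?U \<inter> (F (Suc j) - F j) \<noteq> {}"
        by (simp add: open_Int_closure_eq_empty)
      then show ?thesis by blast
    qed auto
  qed
  then obtain z where z: "\<And>j. j \<le> n \<Longrightarrow> z j \<in> F j" "\<And>j. j < n \<Longrightarrow> z (Suc j) \<notin> F j"
    and step: "\<And>j Z. j < n \<Longrightarrow> Z \<in> \<Z> \<Longrightarrow> z (Suc j) \<in> Z \<Longrightarrow> z j \<in> Z" by blast
  have "z i \<in> Z" if "i \<le> j" "j \<le> n" "Z \<in> \<Z>" "z j \<in> Z" for i j Z
    using that(1,2,4)
  proof (induction rule: dec_induct)
    case (step k)
    then show ?case using that(3) \<open>\<And>j Z. j < n \<Longrightarrow> Z \<in> \<Z> \<Longrightarrow> z (Suc j) \<in> Z \<Longrightarrow> z j \<in> Z\<close>[of k Z] by auto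
  qed
  with z show thesis by (rule that)
qed

section \<open>Balls converging to a point of the compactification\<close>

text \<open>For a Hausdorff space this is the trace on the space of the neighbourhood filter of
  \<open>p\<close> in the one-point compactification, so that finite points and infinity can be
  treated alike.\<close>

definition nbhd_filter :: "'a::topological_space option \<Rightarrow> 'a filter" where
  "nbhd_filter p = (case p of Some x \<Rightarrow> nhds x | None \<Rightarrow> (INF K\<in>{K. compact K}. principal (- K)))"

lemma nbhd_filter_Some [simp]: "nbhd_filter (Some x) = nhds x"
  by (simp add: nbhd_filter_def)

lemma eventually_nbhd_filter_None:
  "eventually P (nbhd_filter None) \<longleftrightarrow> (\<exists>K. compact K \<and> (\<forall>x. x \<notin> K \<longrightarrow> P x))"
proof -
  have "eventually P (INF K\<in>{K. compact K}. principal (- K))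
    \<longleftrightarrow> (\<exists>K\<in>{K. compact K}. eventually P (principal (- K)))"
  proof (rule eventually_INF_base)
    show "{K :: 'a set. compact K} \<noteq> {}" by (auto intro!: exI[of _ "{}"])
    fix A B :: "'a set" assume "A \<in> {K. compact K}" "B \<in> {K. compact K}"
    then show "\<exists>K\<in>{K. compact K}. principal (- K) \<le> inf (principal (- A)) (principal (- B))"
      by (intro bexI[of _ "A \<union> B"]) (auto simp: compact_Un)
  qed
  then show ?thesis by (auto simp: nbhd_filter_def eventually_principal)
qed

lemma eventually_notin_compact:
  assumes "compact (K :: 'a::t2_space set)" "p \<notin> Some ` K"
  shows "eventually (\<lambda>y. y \<notin> K) (nbhd_filter p)"
proof (cases p)
  case None
  with assms show ?thesis by (auto simp: eventually_nbhd_filter_None)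
next
  case (Some x)
  with assms have "x \<in> - K" "open (- K)" by (auto simp: compact_imp_closed open_Compl)
  with Some show ?thesis by (auto simp: eventually_nhds)
qed

lemma compact_cball_exists:
  fixes x :: "'a::metric_space"
  assumes "locally_compact_space (euclidean :: 'a topology)"
  obtains e where "e > 0" "compact (cball x e)"
proof -
  obtain U K where UK: "open U" "compact K" "x \<in> U" "U \<subseteq> K"
    using assms[unfolded locally_compact_space_def, rule_format, of x] by auto
  then obtain e where "e > 0" "cball x e \<subseteq> U" by (meson open_contains_cball)
  then show thesis using UK that[of e] compact_Int_closed[of K "cball x e"] by (simp add: Int_absorb1)
qed

lemma compact_subset_open_compact:
  fixes C :: "'a::metric_space set"
  assumes "locally_compact_space (euclidean :: 'a topology)" "compact C"
  obtains V K where "open V" "compact K" "C \<subseteq> V" "V \<subseteq> K"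
proof -
  have "\<forall>x :: 'a. \<exists>e>0. compact (cball x e)"
    by (rule allI, rule compact_cball_exists[OF assms(1)]) blast
  from choice[OF this] obtain e where "\<forall>x :: 'a. e x > 0 \<and> compact (cball x (e x))"
    by blast
  then have e: "e x > 0" "compact (cball x (e x))" for x
    by blast+
  have "C \<subseteq> (\<Union>x\<in>C. ball x (e x))"
  proof
    fix x assume "x \<in> C"
    then show "x \<in> (\<Union>x\<in>C. ball x (e x))" by (rule UN_I) (simp add: e)
  qed
  then obtain D where "D \<subseteq> C" "finite D" "C \<subseteq> (\<Union>x\<in>D. ball x (e x))"
    by (rule compactE_image[OF \<open>compact C\<close> open_ball])
  moreover have "compact (\<Union>x\<in>D. cball x (e x))"
    using \<open>finite D\<close> e by (intro compact_UN) auto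
  moreover have "(\<Union>x\<in>D. ball x (e x)) \<subseteq> (\<Union>x\<in>D. cball x (e x))"
    by (rule UN_mono) auto
  ultimately show thesis
    by (intro that[of "\<Union>x\<in>D. ball x (e x)" "\<Union>x\<in>D. cball x (e x)"] open_UN ballI open_ball)
qed

text \<open>Ensures that balls converge to \<open>p\<close> once their centres do and their radii
  tend to 0. At infinity, \<delta> is chosen so that the \<delta>-balls around the exceptional
  compact set \<open>C\<close> stay in a compact \<open>K\<close>; then \<delta>-balls around points
  outside \<open>K\<close> miss \<open>C\<close>.\<close>

lemma eventually_nbhd_filter_uniform:
  fixes p :: "'a::metric_space option"
  assumes lc: "locally_compact_space (euclidean :: 'a topology)" and P: "eventually P (nbhd_filter p)"
  obtains \<delta> where "\<delta> > 0" "eventually (\<lambda>x. \<forall>y\<in>cball x \<delta>. P y) (nbhd_filter p)"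
proof (cases p)
  case (Some q)
  with P obtain e where e: "e > 0" "\<And>y. dist y q < e \<Longrightarrow> P y" by (auto simp: eventually_nhds_metric)
  have "\<forall>\<^sub>F x in nhds q. \<forall>y\<in>cball x (e / 2). P y"
    unfolding eventually_nhds_metric
  proof (intro exI[of _ "e / 2"] conjI allI impI ballI)
    fix x y assume "dist x q < e / 2" "y \<in> cball x (e / 2)"
    then show "P y" using dist_triangle[of y q x] by (intro e) (auto simp: dist_commute)
  qed (use e in auto)
  with e Some that[of "e / 2"] show thesis by auto
next
  case None
  with P obtain C where C: "compact C" "\<And>y. y \<notin> C \<Longrightarrow> P y" by (auto simp: eventually_nbhd_filter_None)
  obtain V K where VK: "open V" "compact K" "C \<subseteq> V" "V \<subseteq> K"
    using compact_subset_open_compact[OF lc \<open>compact C\<close>] .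
  obtain \<delta> where \<delta>: "\<delta> > 0" "(\<Union>x\<in>C. cball x \<delta>) \<subseteq> V"
    using compact_subset_open_imp_cball_epsilon_subset[OF \<open>compact C\<close> \<open>open V\<close> \<open>C \<subseteq> V\<close>] by blast
  have "\<forall>y\<in>cball x \<delta>. P y" if "x \<notin> K" for x
  proof
    fix y assume y: "y \<in> cball x \<delta>"
    have "y \<notin> C"
    proof
      assume "y \<in> C"
      moreover have "x \<in> cball y \<delta>" using y by (simp add: dist_commute)
      ultimately show False using \<delta> VK that by blast
    qed
    then show "P y" by (rule C)
  qed
  with VK None have "eventually (\<lambda>x. \<forall>y\<in>cball x \<delta>. P y) (nbhd_filter p)"
    by (auto simp: eventually_nbhd_filter_None)
  with \<delta> show thesis using that by blast
qed

section \<open>Sequences of iterated limit points converging to \<open>p\<close>\<close>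

text \<open>Infinitely many terms in one compact set would yield a convergent subsequence.\<close>

lemma filterlim_nbhd_filter_None:
  fixes x :: "nat \<Rightarrow> 'a::metric_space"
  assumes "\<And>s l. strict_mono (s :: nat \<Rightarrow> nat) \<Longrightarrow> (x \<circ> s) \<longlonglongrightarrow> l \<Longrightarrow> False"
  shows "filterlim x (nbhd_filter None) sequentially"
  unfolding filterlim_iff eventually_nbhd_filter_None
proof safe
  fix P and K :: "'a set" assume K: "compact K" "\<forall>x. x \<notin> K \<longrightarrow> P x"
  have "finite {i. x i \<in> K}"
  proof (rule ccontr)
    assume "infinite {i. x i \<in> K}"
    then obtain s :: "nat \<Rightarrow> nat" where s: "strict_mono s" "\<forall>n. x (s n) \<in> K"
      using infinite_enumerate[of "{i. x i \<in> K}"] by auto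
    then obtain l t where "strict_mono t" "((x \<circ> s) \<circ> t) \<longlonglongrightarrow> l"
      using \<open>compact K\<close> unfolding compact_def by (metis comp_apply)
    then show False using assms[of "s \<circ> t" l] s by (simp add: strict_mono_o o_assoc)
  qed
  then have "\<forall>\<^sub>F i in sequentially. x i \<notin> K"
    by (simp add: eventually_cofinite flip: cofinite_eq_sequentially)
  then show "\<forall>\<^sub>F i in sequentially. P (x i)" by eventually_elim (use K in auto)
qed

text \<open>Open sets of the space remain open in the compactification. Neighbourhoods of
  \<open>Some y\<close> can thus be taken free of infinity, and the induction hypothesis covers the
  points found there.\<close>

lemma iterated_limit_points_Alexandroff_Some:
  "Some y \<in> iterated_limit_points (Alexandroff_compactification euclidean) n
    \<Longrightarrow> y \<in> iterated_limit_points euclidean n"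
proof (induction n arbitrary: y)
  case 0
  then show ?case by simp
next
  case (Suc n)
  let ?S = "iterated_limit_points (Alexandroff_compactification euclidean) n :: 'a option set"
  have y: "Some y \<in> ?S" and
    lim: "\<And>T. openin (Alexandroff_compactification euclidean) T \<Longrightarrow> Some y \<in> T
      \<Longrightarrow> \<exists>z\<noteq>Some y. z \<in> ?S \<and> z \<in> T"
    using Suc.prems by (auto simp: iterated_limit_points.simps(2) limit_points_def in_derived_set_of openin_subtopology)
  have "y islimpt iterated_limit_points euclidean n"
    unfolding islimpt_def
  proof safe
    fix T assume "y \<in> T" "open T"
    then obtain z where "z \<noteq> Some y" "z \<in> ?S" "z \<in> Some ` T"
      using lim[of "Some ` T"] by auto
    with Suc.IH show "\<exists>z\<in>iterated_limit_points euclidean n. z \<in> T \<and> z \<noteq> y" by auto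
  qed
  with y Suc.IH show ?case by (simp add: iterated_limit_points_euclidean_Suc)
qed

text \<open>The complement of \<open>K\<close> together with infinity is a neighbourhood of
  \<open>None\<close>. One level is lost, because a limit point of iterate \<open>n\<close> only
  yields nearby points of iterate \<open>n\<close>.\<close>

lemma iterated_limit_points_Alexandroff_None:
  assumes "None \<in> iterated_limit_points (Alexandroff_compactification (euclidean :: 'a::t2_space topology)) (Suc n)"
    "compact K"
  shows "\<exists>y::'a. y \<in> iterated_limit_points euclidean n \<and> y \<notin> K"
proof -
  let ?T = "insert None (Some ` (- K))"
  let ?S = "iterated_limit_points (Alexandroff_compactification (euclidean :: 'a topology)) n"
  have "openin (Alexandroff_compactification (euclidean :: 'a topology)) ?T"
    unfolding openin_Alexandroff_compactification using \<open>compact K\<close>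
    by (intro disjI2 exI[of _ K]) (simp add: compact_imp_closed Compl_eq_Diff_UNIV)
  moreover have "\<exists>z\<noteq>None. z \<in> ?S \<and> z \<in> T"
    if "openin (Alexandroff_compactification (euclidean :: 'a topology)) T" "None \<in> T" for T
  proof -
    have "None \<in> ?S" and "\<And>U. None \<in> U \<Longrightarrow> openin (subtopology (Alexandroff_compactification euclidean) ?S) U
        \<Longrightarrow> \<exists>y. y \<noteq> None \<and> y \<in> ?S \<and> y \<in> U"
      using assms(1) by (auto simp: iterated_limit_points.simps(2) limit_points_def in_derived_set_of)
    from this(2)[of "T \<inter> ?S"] this(1) that show ?thesis by (auto simp: openin_subtopology)
  qed
  ultimately obtain z where "z \<noteq> None" "z \<in> ?S" "z \<in> ?T"
    by (metis insertI1)
  then show ?thesis using iterated_limit_points_Alexandroff_Some by auto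
qed


lemma sequence_converging_in_iterated_limit_points:
  fixes p :: "'a::metric_space option"
  assumes lc: "locally_compact_space (euclidean :: 'a topology)"
    and p: "p \<in> limit_points_infinity (Alexandroff_compactification (euclidean :: 'a topology))"
  obtains x where "\<And>i. x i \<in> iterated_limit_points euclidean (c i)" "\<And>i. Some (x i) \<noteq> p"
    "filterlim x (nbhd_filter p) sequentially"
proof -
  let ?L = "\<lambda>n. iterated_limit_points euclidean n :: 'a set"
  have p: "p \<in> iterated_limit_points (Alexandroff_compactification (euclidean :: 'a topology)) (Suc n)" for n
    using p by (auto simp: limit_points_infinity_def)
  show thesis
  proof (cases p)
    case (Some q)
    have "\<forall>i. \<exists>y. y \<in> ?L (c i) \<and> y \<noteq> q \<and> dist y q < inverse (real (Suc i))"
    proof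
      fix i
      have "q islimpt ?L (c i)"
        using iterated_limit_points_Alexandroff_Some[OF p[of "c i", unfolded Some]]
        by (simp add: iterated_limit_points_euclidean_Suc)
      then show "\<exists>y. y \<in> ?L (c i) \<and> y \<noteq> q \<and> dist y q < inverse (real (Suc i))"
        unfolding islimpt_approachable by (simp add: Bex_def)
    qed
    from choice[OF this] obtain x
      where x: "x i \<in> ?L (c i)" "x i \<noteq> q" "dist (x i) q < inverse (real (Suc i))" for i
      by blast
    have "(\<lambda>i. dist (x i) q) \<longlonglongrightarrow> 0"
    proof (rule tendsto_sandwich)
      show "\<forall>\<^sub>F i in sequentially. 0 \<le> dist (x i) q" by simp
      show "\<forall>\<^sub>F i in sequentially. dist (x i) q \<le> inverse (real (Suc i))"
        by (intro always_eventually allI less_imp_le x)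
    qed (rule tendsto_const LIMSEQ_inverse_real_of_nat)+
    then have "x \<longlonglongrightarrow> q" by (rule tendsto_dist_iff[THEN iffD2])
    with x Some that show thesis by auto
  next
    case None
    have outside: "\<exists>y \<in> ?L n. y \<notin> K" if "compact K" for n K
      using iterated_limit_points_Alexandroff_None[OF p[of n, unfolded None] that] by blast
    define Y where "Y = (\<Inter>n. ?L n)"
    have "closed Y" unfolding Y_def by (intro closed_INT ballI closed_iterated_limit_points)
    \<comment> \<open>Infinity need not have a countable neighbourhood base, so the points cannot
      simply be chosen from shrinking neighbourhoods; a sequence without convergent subsequences
      does the job. If \<open>Y\<close> is not compact, one exists inside \<open>Y\<close>, which is
      closed.\<close>
    have "\<exists>x. (\<forall>i. x i \<in> ?L (c i)) \<and> (\<forall>s l. strict_mono (s :: nat \<Rightarrow> nat) \<longrightarrow> \<not> (x \<circ> s) \<longlonglongrightarrow> l)"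
    proof (cases "compact Y")
      case False
      then obtain x :: "nat \<Rightarrow> 'a" where x: "\<forall>i. x i \<in> Y"
        and no: "\<not> (\<exists>l\<in>Y. \<exists>s. strict_mono s \<and> (x \<circ> s) \<longlonglongrightarrow> l)"
        unfolding compact_def not_all not_imp by blast
      have "l \<in> Y" if "(x \<circ> s) \<longlonglongrightarrow> l" for s :: "nat \<Rightarrow> nat" and l
        using closed_sequentially[OF \<open>closed Y\<close> _ that] x by simp
      with no have "\<forall>s l. strict_mono (s :: nat \<Rightarrow> nat) \<longrightarrow> \<not> (x \<circ> s) \<longlonglongrightarrow> l" by blast
      with x show ?thesis by (intro exI[of _ x]) (simp add: Y_def)
    next
      case True
      then obtain V K where VK: "open V" "compact K" "Y \<subseteq> V" "V \<subseteq> K"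
        by (rule compact_subset_open_compact[OF lc])
      \<comment> \<open>The extra \<open>i\<close> puts every subsequential limit into all iterates,
        hence into \<open>Y\<close> and \<open>V\<close>, whereas all terms avoid the open set
        \<open>V\<close>.\<close>
      have "\<forall>i. \<exists>y. y \<in> ?L (c i + i) \<and> y \<notin> K"
        using outside[OF VK(2)] by blast
      from choice[OF this] obtain x where x: "x i \<in> ?L (c i + i)" "x i \<notin> K" for i
        by blast
      have "\<not> (x \<circ> s) \<longlonglongrightarrow> l" if s: "strict_mono s" for s :: "nat \<Rightarrow> nat" and l
      proof
        assume l: "(x \<circ> s) \<longlonglongrightarrow> l"
        have "l \<in> ?L n" for n
        proof (rule Lim_in_closed_set[OF closed_iterated_limit_points _ _ l])
          have "x (s i) \<in> ?L n" if "n \<le> i" for i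
            using x(1)[of "s i"] iterated_limit_points_antimono[of n "c (s i) + s i"] that seq_suble[OF s, of i]
            by auto
          then show "\<forall>\<^sub>F i in sequentially. (x \<circ> s) i \<in> ?L n"
            by (auto simp: eventually_sequentially)
        qed simp
        then have "l \<in> V" using VK by (auto simp: Y_def)
        moreover have "l \<in> - V"
        proof (rule Lim_in_closed_set[OF _ _ _ l])
          show "\<forall>\<^sub>F i in sequentially. (x \<circ> s) i \<in> - V"
            using VK x by (intro always_eventually) auto
        qed (use VK in auto)
        ultimately show False by simp
      qed
      moreover have "x i \<in> ?L (c i)" for i
        using x(1)[of i] iterated_limit_points_antimono[of "c i" "c i + i"] by auto
      ultimately show ?thesis by blast
    qed
    then obtain x where x: "\<forall>i. x i \<in> ?L (c i)"
      and no: "\<forall>s l. strict_mono (s :: nat \<Rightarrow> nat) \<longrightarrow> \<not> (x \<circ> s) \<longlonglongrightarrow> l" by blast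
    have "filterlim x (nbhd_filter None) sequentially"
      by (rule filterlim_nbhd_filter_None) (use no in blast)
    with x None that[of x] show thesis by simp
  qed
qed

text \<open>A subsequence is chosen recursively: each new centre lies outside the compact union of
  the earlier balls, which the sequence eventually leaves because that union misses
  \<open>p\<close>.\<close>

lemma balls_converging:
  fixes p :: "'a::metric_space option"
  assumes lc: "locally_compact_space (euclidean :: 'a topology)"
    and p: "p \<in> limit_points_infinity (Alexandroff_compactification (euclidean :: 'a topology))"
  obtains x r where "\<And>i. x i \<in> iterated_limit_points euclidean (b i)" "\<And>i :: nat. r i > (0::real)"
    "\<And>i. compact (cball (x i) (2 * r i))" "\<And>i. r i \<le> 1" "\<And>i j. i \<noteq> j \<Longrightarrow> cball (x i) (r i) \<inter> cball (x j) (r j) = {}"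
    "\<And>i. p \<notin> Some ` cball (x i) (r i)"
    "\<And>P. eventually P (nbhd_filter p) \<Longrightarrow> \<forall>\<^sub>F i in sequentially. \<forall>y\<in>cball (x i) (r i). P y"
proof -
  \<comment> \<open>Partial sums survive the passage to a subsequence \<open>s\<close>: as
    \<open>i\<close> is at most \<open>s i\<close>, the sum up to \<open>s i\<close> still dominates
    \<open>b i\<close>, although \<open>b\<close> need not be monotone.\<close>
  obtain x where x: "\<And>i. x i \<in> iterated_limit_points euclidean (\<Sum>k\<le>i. b k)" "\<And>i. Some (x i) \<noteq> p"
    and lim: "filterlim x (nbhd_filter p) sequentially"
    by (rule sequence_converging_in_iterated_limit_points[OF lc p, where c = "\<lambda>i. \<Sum>k\<le>i. b k"], rule that)
  define G where "G m \<epsilon> K i r \<longleftrightarrow> m < i \<and> 0 < r \<and> r \<le> \<epsilon> \<and> compact (cball (x i) (2 * r)) \<and>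
    cball (x i) r \<inter> K = {} \<and> p \<notin> Some ` cball (x i) r" for m \<epsilon> K i r
  have step: "\<exists>i r. G m \<epsilon> K i r" if K: "compact K" "p \<notin> Some ` K" and "\<epsilon> > 0" for m K and \<epsilon> :: real
  proof -
    have "\<forall>\<^sub>F i in sequentially. x i \<notin> K"
      using lim eventually_notin_compact[OF K] unfolding filterlim_iff by blast
    then have "\<forall>\<^sub>F i in sequentially. m < i \<and> x i \<notin> K"
      using eventually_gt_at_top by eventually_elim simp
    then obtain i where i: "m < i" "x i \<notin> K" by (auto simp: eventually_sequentially)
    have "closed (K \<union> set_option p)"
      using K by (intro closed_Un) (auto simp: compact_imp_closed finite_imp_closed)
    then have "open (- (K \<union> set_option p))" by (rule open_Compl)
    moreover have "x i \<in> - (K \<union> set_option p)"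
      using i x(2)[of i] by auto
    ultimately obtain e where e: "e > 0" "cball (x i) e \<subseteq> - (K \<union> set_option p)"
      by (meson open_contains_cball)
    obtain d where d: "d > 0" "compact (cball (x i) d)" using compact_cball_exists[OF lc] .
    define r where "r = Min {e, d / 2, \<epsilon>}"
    have r: "r > 0" "r \<le> e" "2 * r \<le> d" "r \<le> \<epsilon>"
      using e d \<open>\<epsilon> > 0\<close> by (auto simp: r_def)
    have "compact (cball (x i) (2 * r))"
      using r d compact_Int_closed[of "cball (x i) d" "cball (x i) (2 * r)"]
      by (simp add: Int_absorb1 subset_cball)
    moreover have "cball (x i) r \<subseteq> cball (x i) e" using r by (simp add: subset_cball)
    ultimately have "G m \<epsilon> K i r" using e r i by (fastforce simp: G_def)
    then show ?thesis by blast
  qed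
  \<comment> \<open>The state consists of an index, a radius and a compact set \<open>K\<close>
    absorbing all balls chosen so far.\<close>
  define P where "P n t \<longleftrightarrow> (case t of (i, r, K) \<Rightarrow>
    compact K \<and> p \<notin> Some ` K \<and> cball (x i) r \<subseteq> K \<and> G 0 (inverse (real (Suc n))) {} i r)"
    for n and t :: "nat \<times> real \<times> 'a set"
  define Q where "Q t t' \<longleftrightarrow> (case t of (i, r, K) \<Rightarrow> case t' of (i', r', K') \<Rightarrow>
    i < i' \<and> K \<subseteq> K' \<and> cball (x i') r' \<inter> K = {})"
    for t t' :: "nat \<times> real \<times> 'a set"
  have half: "compact (cball y (r :: real))" if "compact (cball y (2 * r))" "r > 0" for y :: 'a and r
    using that compact_Int_closed[of "cball y (2 * r)" "cball y r"]
    by (simp add: Int_absorb1 subset_cball)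
  have "\<exists>f. \<forall>n. P n (f n) \<and> Q (f n) (f (Suc n))"
  proof (rule dependent_nat_choice)
    obtain i r where "G 0 1 {} i r" using step[of "{}" 1 0] by auto
    then have "P 0 (i, r, cball (x i) r)" by (auto simp: P_def G_def half)
    then show "\<exists>t. P 0 t" ..
  next
    fix t n assume t: "P n t"
    obtain i r K where [simp]: "t = (i, r, K)" by (cases t)
    obtain i' r' where g: "G i (inverse (real (Suc (Suc n)))) K i' r'"
      using step[of K "inverse (real (Suc (Suc n)))" i] t by (auto simp: P_def)
    have "P (Suc n) (i', r', K \<union> cball (x i') r')"
      using g t by (auto simp: P_def G_def half intro!: compact_Un)
    moreover have "Q t (i', r', K \<union> cball (x i') r')"
      using g by (auto simp: Q_def G_def)
    ultimately show "\<exists>t'. P (Suc n) t' \<and> Q t t'" by blast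
  qed
  then obtain f where f: "\<And>n. P n (f n)" "\<And>n. Q (f n) (f (Suc n))" by blast
  define s r K where "s n = fst (f n)" and "r n = fst (snd (f n))" and "K n = snd (snd (f n))" for n
  have f_eq: "f n = (s n, r n, K n)" for n by (simp add: s_def r_def K_def)
  have P: "p \<notin> Some ` K n" "cball (x (s n)) (r n) \<subseteq> K n" "0 < r n" "r n \<le> inverse (real (Suc n))"
    "compact (cball (x (s n)) (2 * r n))" for n
    using f(1)[of n] by (auto simp: P_def G_def f_eq)
  have Q: "s n < s (Suc n)" "K n \<subseteq> K (Suc n)" "cball (x (s (Suc n))) (r (Suc n)) \<inter> K n = {}" for n
    using f(2)[of n] by (auto simp: Q_def f_eq)
  have s: "strict_mono s" using Q(1) by (simp add: strict_mono_Suc_iff)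
  have K_mono: "K m \<subseteq> K n" if "m \<le> n" for m n
    using Q(2) that by (rule lift_Suc_mono_le)
  have disj: "cball (x (s i)) (r i) \<inter> cball (x (s j)) (r j) = {}" if "i < j" for i j
  proof -
    have "j = Suc (j - 1)" "i \<le> j - 1" using that by auto
    then obtain k where k: "j = Suc k" "i \<le> k" by blast
    then show ?thesis using P(2)[of i] K_mono[of i k] Q(3)[of k] by blast
  qed
  show thesis
  proof (rule that[of "x \<circ> s" r])
    fix i
    have "b i \<le> (\<Sum>k\<le>s i. b k)"
      by (rule member_le_sum) (use seq_suble[OF s, of i] in auto)
    then show "(x \<circ> s) i \<in> iterated_limit_points euclidean (b i)"
      using x(1)[of "s i"] iterated_limit_points_antimono by auto
    show "r i \<le> 1" using P(4)[of i] by (rule order_trans) (simp add: inverse_le_1_iff)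
    show "p \<notin> Some ` cball ((x \<circ> s) i) (r i)" using P(1,2)[of i] by auto
    fix j assume "i \<noteq> j"
    then show "cball ((x \<circ> s) i) (r i) \<inter> cball ((x \<circ> s) j) (r j) = {}"
      using disj[of i j] disj[of j i] by (cases "i < j") auto
  next
    fix P assume "eventually P (nbhd_filter p)"
    then obtain \<delta> where \<delta>: "\<delta> > 0" "eventually (\<lambda>x. \<forall>y\<in>cball x \<delta>. P y) (nbhd_filter p)"
      using eventually_nbhd_filter_uniform[OF lc] by blast
    have "\<forall>\<^sub>F i in sequentially. \<forall>y\<in>cball (x (s i)) \<delta>. P y"
      using filterlim_compose[OF lim filterlim_subseq[OF s]] \<delta>(2) unfolding filterlim_iff by blast
    moreover have "\<forall>\<^sub>F i in sequentially. inverse (real (Suc i)) < \<delta>"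
      using LIMSEQ_inverse_real_of_nat \<delta>(1) by (rule order_tendstoD)
    ultimately show "\<forall>\<^sub>F i in sequentially. \<forall>y\<in>cball ((x \<circ> s) i) (r i). P y"
    proof eventually_elim
      case (elim i)
      then have "cball (x (s i)) (r i) \<subseteq> cball (x (s i)) \<delta>"
        using P(4)[of i] by (intro subset_cball) simp
      with elim show ?case by auto
    qed
  qed (use P in auto)
qed


section \<open>Prime z-filters\<close>

lemma zero_set_mem_zero_sets:
  fixes f :: "'a::topological_space \<Rightarrow> 'k::real_normed_field"
  shows "f \<in> continuous_functions \<Longrightarrow> zero_set f \<in> zero_sets TYPE('k)"
  by (simp add: zero_sets_def)

text \<open>Truncation at 1 keeps products with functions vanishing at infinity in
  \<open>C0_functions\<close>. The empty set is treated apart because \<open>infdist\<close> to it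
  is 0 by convention.\<close>

definition separator :: "'a::metric_space set \<Rightarrow> 'a \<Rightarrow> 'k::real_normed_field" where
  "separator Z x = (if Z = {} then 1 else of_real (min 1 (infdist x Z)))"

lemma continuous_separator: "separator Z \<in> continuous_functions"
  unfolding continuous_functions_def separator_def
  by (cases "Z = {}") (auto intro!: continuous_intros)

lemma norm_separator_le_1: "norm (separator Z x) \<le> 1"
  using infdist_nonneg[of x Z] by (auto simp: separator_def)

lemma zero_set_separator:
  assumes "closed Z"
  shows "zero_set (separator Z) = Z"
proof -
  have "separator Z x = 0 \<longleftrightarrow> x \<in> Z" for x
  proof (cases "Z = {}")
    case False
    then show ?thesis
      using in_closed_iff_infdist_zero[OF assms False, of x] by (simp add: separator_def min_def)
  qed (simp add: separator_def)
  then show ?thesis by (auto simp: zero_set_def)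
qed

lemma zero_sets_eq_closed:
  "zero_sets TYPE('k::real_normed_field) = {Z :: 'a::metric_space set. closed Z}"
proof -
  have "closed (zero_set f)" if "f \<in> continuous_functions" for f :: "'a \<Rightarrow> 'k"
    using that by (simp add: continuous_functions_def zero_set_def closed_vimage)
  moreover have "Z \<in> zero_sets TYPE('k)" if "closed Z" for Z :: "'a set"
  proof -
    have "zero_set (separator Z :: 'a \<Rightarrow> 'k) \<in> zero_sets TYPE('k)"
      by (rule zero_set_mem_zero_sets[OF continuous_separator])
    with that show ?thesis by (simp add: zero_set_separator)
  qed
  ultimately show ?thesis by (auto simp: zero_sets_def)
qed

text \<open>These are the closed members of the image ultrafilter of \<open>U\<close> under
  \<open>y\<close>; primeness is inherited from the ultrafilter.\<close>

lemma prime_z_filter_ultralimit: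
  fixes y :: "'t \<Rightarrow> 'a::metric_space"
  assumes "U \<noteq> bot" and ultra: "\<And>P. eventually P U \<or> eventually (\<lambda>x. \<not> P x) U"
  shows "prime_z_filter TYPE('k::real_normed_field) {Z. closed Z \<and> (\<forall>\<^sub>F t in U. y t \<in> Z)}"
    (is "prime_z_filter _ ?P")
proof -
  have "UNIV \<in> ?P" "{} \<notin> ?P" using \<open>U \<noteq> bot\<close> by (auto simp: eventually_False)
  moreover have "Y \<inter> Z \<in> ?P" if "Y \<in> ?P" "Z \<in> ?P" for Y Z
    using that by (auto simp: eventually_conj_iff)
  moreover have "Z \<in> ?P" if "Y \<in> ?P" "closed Z" "Y \<subseteq> Z" for Y Z
    using that by (auto elim: eventually_mono)
  ultimately have "z_filter TYPE('k) ?P"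
    unfolding z_filter_def zero_sets_eq_closed by blast
  moreover have "Y \<union> Z \<notin> ?P" if "closed Y" "closed Z" "Y \<notin> ?P" "Z \<notin> ?P" for Y Z
  proof
    assume "Y \<union> Z \<in> ?P"
    then have "\<forall>\<^sub>F t in U. y t \<in> Y \<or> y t \<in> Z" by simp
    moreover have "\<forall>\<^sub>F t in U. y t \<notin> Y" "\<forall>\<^sub>F t in U. y t \<notin> Z"
      using that ultra[of "\<lambda>t. y t \<in> Y"] ultra[of "\<lambda>t. y t \<in> Z"] by auto
    ultimately have "\<forall>\<^sub>F t in U. False" by eventually_elim blast
    with \<open>U \<noteq> bot\<close> show False by (simp add: eventually_False)
  qed
  ultimately show ?thesis
    unfolding prime_z_filter_def zero_sets_eq_closed by blast
qed

section \<open>Chains of prime z-filters from finite approximations\<close>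

text \<open>Finite satisfiability of the desired chain: \<open>y \<alpha>\<close> stands in for
  filter \<alpha>. The set \<open>S \<alpha>\<close> is to belong to filter \<alpha> but to no later
  one, \<open>B\<close> is to meet every member, and \<open>N\<close> provides the sets that must be
  members.\<close>

definition finitely_separated ::
  "'a::topological_space filter \<Rightarrow> ('i \<Rightarrow> 'i \<Rightarrow> bool) \<Rightarrow> ('i \<Rightarrow> 'a set) \<Rightarrow> 'a set \<Rightarrow> bool" where
  "finitely_separated N lt S B \<longleftrightarrow>
    (\<forall>A \<Z>. finite A \<longrightarrow> finite \<Z> \<longrightarrow> (\<forall>Z\<in>\<Z>. closed Z) \<longrightarrow>
      (\<exists>y. (\<forall>\<alpha>\<in>A. y \<alpha> \<in> S \<alpha> \<inter> B \<and> (\<forall>Z\<in>\<Z>. eventually (\<lambda>x. x \<in> Z) N \<longrightarrow> y \<alpha> \<in> Z)) \<and>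
        (\<forall>\<alpha>\<in>A. \<forall>\<beta>\<in>A. lt \<alpha> \<beta> \<longrightarrow> y \<beta> \<notin> S \<alpha> \<and> (\<forall>Z\<in>\<Z>. y \<beta> \<in> Z \<longrightarrow> y \<alpha> \<in> Z))))"

text \<open>Any finite part of the chain of prime filters is approximated by principal filters at points,
  so a limit along an ultrafilter on the finite sets of requirements yields the whole chain.\<close>
lemma prime_z_filter_chain:
  fixes S :: "'i \<Rightarrow> 'a::metric_space set" and lt :: "'i \<Rightarrow> 'i \<Rightarrow> bool" and B :: "'a set"
  assumes fin: "finitely_separated N lt S B"
    and closed: "\<And>\<alpha>. closed (S \<alpha>)"
  obtains P :: "'i \<Rightarrow> 'a set set"
  where "\<And>\<alpha>. prime_z_filter TYPE('k::real_normed_field) (P \<alpha>)"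
    "\<And>\<alpha> Z. closed Z \<Longrightarrow> eventually (\<lambda>x. x \<in> Z) N \<Longrightarrow> Z \<in> P \<alpha>"
    "\<And>\<alpha> Z. Z \<in> P \<alpha> \<Longrightarrow> Z \<inter> B \<noteq> {}"
    "\<And>\<alpha> \<beta>. lt \<alpha> \<beta> \<Longrightarrow> P \<beta> \<subset> P \<alpha>"
proof -
  \<comment> \<open>A finite set of pairs records finitely many indices and test sets at once.
    Closedness appears as a premise because the second components are arbitrary sets.\<close>
  define good where "good t y \<longleftrightarrow>
    (\<forall>\<alpha> Z. (\<alpha>, Z) \<in> t \<longrightarrow>
      y \<alpha> \<in> S \<alpha> \<inter> B \<and> (closed Z \<longrightarrow> eventually (\<lambda>x. x \<in> Z) N \<longrightarrow> y \<alpha> \<in> Z)) \<and>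
    (\<forall>\<alpha> \<beta> Z. (\<alpha>, Z) \<in> t \<longrightarrow> (\<beta>, Z) \<in> t \<longrightarrow> lt \<alpha> \<beta> \<longrightarrow>
      y \<beta> \<notin> S \<alpha> \<and> (closed Z \<longrightarrow> y \<beta> \<in> Z \<longrightarrow> y \<alpha> \<in> Z))" for t :: "('i \<times> 'a set) set" and y
  define y where "y t = (SOME y. good t y)" for t
  have good: "good t (y t)" if t: "finite t" for t
  proof -
    have mem: "\<alpha> \<in> fst ` t" "Z \<in> snd ` t" if "(\<alpha>, Z) \<in> t" for \<alpha> Z
      using that by force+
    let ?\<Z> = "{Z \<in> snd ` t. closed Z}"
    have "\<exists>y. (\<forall>\<alpha>\<in>fst ` t. y \<alpha> \<in> S \<alpha> \<inter> B \<and> (\<forall>Z\<in>?\<Z>. eventually (\<lambda>x. x \<in> Z) N \<longrightarrow> y \<alpha> \<in> Z)) \<and>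
        (\<forall>\<alpha>\<in>fst ` t. \<forall>\<beta>\<in>fst ` t. lt \<alpha> \<beta> \<longrightarrow> y \<beta> \<notin> S \<alpha> \<and> (\<forall>Z\<in>?\<Z>. y \<beta> \<in> Z \<longrightarrow> y \<alpha> \<in> Z))"
      by (rule fin[unfolded finitely_separated_def, THEN spec, THEN spec, THEN mp, THEN mp, THEN mp])
        (use t in auto)
    then obtain y where
      y: "\<forall>\<alpha>\<in>fst ` t. y \<alpha> \<in> S \<alpha> \<inter> B \<and> (\<forall>Z\<in>?\<Z>. eventually (\<lambda>x. x \<in> Z) N \<longrightarrow> y \<alpha> \<in> Z)"
        "\<forall>\<alpha>\<in>fst ` t. \<forall>\<beta>\<in>fst ` t. lt \<alpha> \<beta> \<longrightarrow> y \<beta> \<notin> S \<alpha> \<and> (\<forall>Z\<in>?\<Z>. y \<beta> \<in> Z \<longrightarrow> y \<alpha> \<in> Z)"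
      by (elim exE conjE) (rule that)
    have "good t y"
      unfolding good_def
    proof (intro conjI allI impI)
      fix \<alpha> Z assume "(\<alpha>, Z) \<in> t"
      note m = mem[OF this]
      show "y \<alpha> \<in> S \<alpha> \<inter> B" using y(1) m by blast
      show "y \<alpha> \<in> Z" if "closed Z" "eventually (\<lambda>x. x \<in> Z) N" using y(1) m that by blast
      fix \<beta> assume "(\<beta>, Z) \<in> t" "lt \<alpha> \<beta>"
      with mem(1) have m': "\<beta> \<in> fst ` t" "lt \<alpha> \<beta>" by auto
      show "y \<beta> \<notin> S \<alpha>" using y(2) m m' by blast
      show "y \<alpha> \<in> Z" if "closed Z" "y \<beta> \<in> Z" using y(2) m m' that by blast
    qed
    then show ?thesis unfolding y_def by (rule someI[of "good t"])
  qed
  have good_mem: "y \<alpha> \<in> S \<alpha> \<inter> B" if "good t y" "(\<alpha>, Z) \<in> t" for t y \<alpha> Z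
    using that unfolding good_def by blast
  have good_nbhd: "y \<alpha> \<in> Z"
    if "good t y" "(\<alpha>, Z) \<in> t" "closed Z" "eventually (\<lambda>x. x \<in> Z) N" for t y \<alpha> Z
    using that unfolding good_def by blast
  have good_less: "y \<beta> \<notin> S \<alpha>" "closed Z \<Longrightarrow> y \<beta> \<in> Z \<Longrightarrow> y \<alpha> \<in> Z"
    if "good t y" "(\<alpha>, Z) \<in> t" "(\<beta>, Z) \<in> t" "lt \<alpha> \<beta>" for t y \<alpha> \<beta> Z
    using that unfolding good_def by blast+
  obtain U :: "('i \<times> 'a set) set filter" where U: "U \<le> finite_subsets_at_top UNIV" "U \<noteq> bot"
    and ultra: "\<And>P. eventually P U \<or> eventually (\<lambda>x. \<not> P x) U"
    using ultrafilter_exists[of "finite_subsets_at_top UNIV"] by auto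
  \<comment> \<open>Since \<open>U\<close> refines the filter of finite subsets, any finitely many
    requirements are met by almost every \<open>t\<close>.\<close>
  have ev: "\<forall>\<^sub>F t in U. X \<subseteq> t \<and> good t (y t)" if "finite X" for X
    by (rule filter_leD[OF U(1)])
      (use that good in \<open>auto simp: eventually_finite_subsets_at_top intro!: exI[of _ X]\<close>)
  define P where "P \<alpha> = {Z. closed Z \<and> (\<forall>\<^sub>F t in U. y t \<alpha> \<in> Z)}" for \<alpha>
  \<comment> \<open>\<open>UNIV\<close> is a dummy second component; only the presence of the index
    matters.\<close>
  have inB: "\<forall>\<^sub>F t in U. y t \<alpha> \<in> S \<alpha> \<inter> B" for \<alpha>
    by (rule eventually_mono[OF ev[of "{(\<alpha>, UNIV)}"]]) (use good_mem in blast)+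
  show thesis
  proof (rule that[of P])
    show "prime_z_filter TYPE('k) (P \<alpha>)" for \<alpha>
      unfolding P_def using U(2) ultra by (rule prime_z_filter_ultralimit)
    show "Z \<in> P \<alpha>" if "closed Z" "eventually (\<lambda>x. x \<in> Z) N" for \<alpha> Z
    proof -
      have "\<forall>\<^sub>F t in U. y t \<alpha> \<in> Z"
        by (rule eventually_mono[OF ev[of "{(\<alpha>, Z)}"]]) (use good_nbhd that in blast)+
      with that show ?thesis by (simp add: P_def)
    qed
    show "Z \<inter> B \<noteq> {}" if "Z \<in> P \<alpha>" for \<alpha> Z
    proof
      assume "Z \<inter> B = {}"
      from that have "\<forall>\<^sub>F t in U. y t \<alpha> \<in> Z" by (simp add: P_def)
      with inB[of \<alpha>] have "\<forall>\<^sub>F t in U. False"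
        by eventually_elim (use \<open>Z \<inter> B = {}\<close> in blast)
      with U(2) show False by (simp add: eventually_False)
    qed
    fix \<alpha> \<beta> assume lt: "lt \<alpha> \<beta>"
    have "P \<beta> \<subseteq> P \<alpha>"
    proof
      fix Z assume Z: "Z \<in> P \<beta>"
      then have "closed Z" "\<forall>\<^sub>F t in U. y t \<beta> \<in> Z" by (auto simp: P_def)
      have "\<forall>\<^sub>F t in U. y t \<beta> \<in> Z \<longrightarrow> y t \<alpha> \<in> Z"
        by (rule eventually_mono[OF ev[of "{(\<alpha>, Z), (\<beta>, Z)}"]])
          (use good_less(2)[OF _ _ _ lt] \<open>closed Z\<close> in blast)+
      with \<open>\<forall>\<^sub>F t in U. y t \<beta> \<in> Z\<close> have "\<forall>\<^sub>F t in U. y t \<alpha> \<in> Z"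
        by eventually_elim blast
      with \<open>closed Z\<close> show "Z \<in> P \<alpha>" by (simp add: P_def)
    qed
    moreover have "S \<alpha> \<in> P \<alpha>"
      using closed eventually_mono[OF inB[of \<alpha>], of "\<lambda>t. y t \<alpha> \<in> S \<alpha>"] by (simp add: P_def)
    moreover have "S \<alpha> \<notin> P \<beta>"
    proof
      assume "S \<alpha> \<in> P \<beta>"
      then have "\<forall>\<^sub>F t in U. y t \<beta> \<in> S \<alpha>" by (simp add: P_def)
      moreover have "\<forall>\<^sub>F t in U. {(\<alpha>, UNIV), (\<beta>, UNIV)} \<subseteq> t \<and> good t (y t)" by (rule ev) simp
      ultimately have "\<forall>\<^sub>F t in U. False"
        by eventually_elim (use good_less(1)[OF _ _ _ lt] in blast)
      with U(2) show False by (simp add: eventually_False)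
    qed
    ultimately show "P \<beta> \<subset> P \<alpha>" by blast
  qed
qed

text \<open>A compact ball around a point outside the union, chosen to miss \<open>p\<close>, meets
  only finitely many \<open>C i\<close>; removing these from the open ball leaves a neighbourhood
  disjoint from the union.\<close>

lemma closed_union_converging:
  fixes p :: "'a::metric_space option"
  assumes lc: "locally_compact_space (euclidean :: 'a topology)"
    and conv: "\<And>P. eventually P (nbhd_filter p) \<Longrightarrow> \<forall>\<^sub>F i in sequentially. \<forall>y\<in>C i. P y"
    and closed: "\<And>i :: nat. closed (C i)"
  shows "closed (set_option p \<union> (\<Union>i. C i))" (is "closed ?S")
proof -
  have "\<exists>T. open T \<and> z \<in> T \<and> T \<subseteq> - ?S" if z: "z \<in> - ?S" for z
  proof -
    obtain d where d: "d > 0" "compact (cball z d)" using compact_cball_exists[OF lc] .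
    have "open (- set_option p)" "z \<in> - set_option p"
      using z by (auto intro!: open_Compl finite_imp_closed)
    then obtain e where e: "e > 0" "cball z e \<subseteq> - set_option p" by (meson open_contains_cball)
    define r where "r = min d e"
    have r: "r > 0" "cball z r \<subseteq> cball z d" "cball z r \<subseteq> cball z e"
      using d e by (auto simp: r_def)
    have "compact (cball z r)"
      using d(2) r(2) compact_Int_closed[of "cball z d" "cball z r"] by (simp add: Int_absorb1)
    moreover have "p \<notin> Some ` cball z r" using e(2) r(3) by fastforce
    ultimately have "\<forall>\<^sub>F i in sequentially. \<forall>y\<in>C i. y \<notin> cball z r"
      by (intro conv eventually_notin_compact)
    then obtain n where n: "\<And>i. n \<le> i \<Longrightarrow> C i \<inter> cball z r = {}"
      unfolding eventually_sequentially by blast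
    let ?T = "ball z r - (\<Union>i<n. C i)"
    have "open ?T" using closed by (intro open_Diff closed_UN) auto
    moreover have "z \<in> ?T" using z r by auto
    moreover have "?T \<subseteq> - ?S"
    proof
      fix y assume y: "y \<in> ?T"
      then have "y \<in> cball z r" by (simp add: less_imp_le)
      then have "y \<notin> C i" for i using y n[of i] by (cases "i < n") auto
      moreover have "y \<notin> set_option p" using \<open>y \<in> cball z r\<close> e(2) r(3) by blast
      ultimately show "y \<in> - ?S" by blast
    qed
    ultimately show ?thesis by blast
  qed
  then have "open (- ?S)" by (subst open_subopen) blast
  then show ?thesis by (simp add: closed_def)
qed

section \<open>Approximating points in the converging balls\<close>

lemma separated_points:
  fixes p :: "'a::metric_space option" and lt :: "(nat \<Rightarrow> bool) \<Rightarrow> (nat \<Rightarrow> bool) \<Rightarrow> bool"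
  assumes lc: "locally_compact_space (euclidean :: 'a topology)"
    and p: "p \<in> limit_points_infinity (Alexandroff_compactification (euclidean :: 'a topology))"
    and lt: "transp lt" "irreflp lt"
  obtains x r and S :: "(nat \<Rightarrow> bool) \<Rightarrow> 'a set"
  where "\<And>i :: nat. r i > (0::real)" "\<And>i. r i \<le> 1" "\<And>i. compact (cball (x i) (2 * r i))"
    "\<And>\<alpha>. closed (S \<alpha>)"
    "finitely_separated (nbhd_filter p) lt S (\<Union>i. cball (x i) (r i))"
proof -
  obtain h :: "(nat \<Rightarrow> bool) \<Rightarrow> nat \<Rightarrow> nat" and b where hb: "\<And>\<alpha> i. h \<alpha> i \<le> b i"
    and h: "\<And>A g. finite A \<Longrightarrow> infinite {i. \<forall>\<alpha>\<in>A. h \<alpha> i = g \<alpha>}"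
    by (rule independent_functions) (rule that)
  obtain x r where x: "\<And>i. x i \<in> iterated_limit_points euclidean (b i)" and r: "\<And>i. r i > 0"
    "\<And>i. compact (cball (x i) (2 * r i))" "\<And>i. r i \<le> 1"
    and disj: "\<And>i j. i \<noteq> j \<Longrightarrow> cball (x i) (r i) \<inter> cball (x j) (r j) = {}"
    and pnot: "\<And>i. p \<notin> Some ` cball (x i) (r i)"
    and conv: "\<And>P. eventually P (nbhd_filter p) \<Longrightarrow> \<forall>\<^sub>F i in sequentially. \<forall>y\<in>cball (x i) (r i). P y"
    by (rule balls_converging[OF lc p, of b]) (rule that)
  define layers where "layers i F \<longleftrightarrow> F 0 = {x i} \<and>
    (\<forall>j\<le>b i. closed (F j) \<and> F j \<subseteq> cball (x i) (r i)) \<and>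
    (\<forall>j<b i. F j \<subseteq> F (Suc j) \<and> F j \<subseteq> closure (F (Suc j) - F j))" for i F
  have "\<forall>i. \<exists>F. layers i F"
  proof (rule allI, rule layers_exist[OF x r(1)])
    fix i F assume F: "F 0 = {x i}" "\<And>j. j \<le> b i \<Longrightarrow> closed (F j)"
      "\<And>j. j \<le> b i \<Longrightarrow> F j \<subseteq> ball (x i) (r i)" "\<And>j. j < b i \<Longrightarrow> F j \<subseteq> F (Suc j)"
      "\<And>j. j < b i \<Longrightarrow> F j \<subseteq> closure (F (Suc j) - F j)"
    then have "layers i F"
      unfolding layers_def using ball_subset_cball[of "x i" "r i"] by blast
    then show "\<exists>F. layers i F" by (rule exI[of _ F])
  qed
  from choice[OF this] obtain F where F: "\<And>i. layers i (F i)" by blast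
  have F0: "F i 0 = {x i}" for i using F by (simp add: layers_def)
  have Fball: "F i j \<subseteq> cball (x i) (r i)" "closed (F i j)" if "j \<le> b i" for i j
    using F that unfolding layers_def by blast+
  have Fclosure: "F i j \<subseteq> closure (F i (Suc j) - F i j)" if "j < b i" for i j
    using F that unfolding layers_def by blast
  have Fmono: "F i j \<subseteq> F i k" if "j \<le> k" "k \<le> b i" for i j k
    using that
  proof (induction rule: dec_induct)
    case (step k)
    with F[of i] show ?case unfolding layers_def by (meson Suc_leD Suc_le_lessD order_trans)
  qed simp
  \<comment> \<open>Adding a finite \<open>p\<close> makes the union closed; at infinity nothing is
    added. No ball contains \<open>p\<close>, so the separation inside the balls is
    unaffected.\<close>
  define S where "S \<alpha> = set_option p \<union> (\<Union>i. F i (h \<alpha> i))" for \<alpha>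
  show thesis
  proof (rule that[of r x S])
    show "closed (S \<alpha>)" for \<alpha>
      unfolding S_def
    proof (rule closed_union_converging[OF lc])
      fix P assume "eventually P (nbhd_filter p)"
      from conv[OF this] show "\<forall>\<^sub>F i in sequentially. \<forall>y\<in>F i (h \<alpha> i). P y"
        by (rule eventually_mono) (use Fball(1)[OF hb[of \<alpha>]] in blast)
    qed (rule Fball hb)+
  next
    show "finitely_separated (nbhd_filter p) lt S (\<Union>i. cball (x i) (r i))"
      unfolding finitely_separated_def
    proof (intro allI impI)
      fix A :: "(nat \<Rightarrow> bool) set" and \<Z> :: "'a set set"
      assume fin: "finite A" "finite \<Z>" and "\<forall>Z\<in>\<Z>. closed Z"
      then have closed: "\<And>Z. Z \<in> \<Z> \<Longrightarrow> closed Z" by blast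
      \<comment> \<open>Counting predecessors inside \<open>A\<close> turns any order of the indices
        into an increasing numbering of layers.\<close>
      define rank where "rank \<alpha> = card {\<gamma>\<in>A. lt \<gamma> \<alpha>}" for \<alpha>
      have rank: "rank \<alpha> < rank \<beta>" if "lt \<alpha> \<beta>" "\<alpha> \<in> A" for \<alpha> \<beta>
        unfolding rank_def
      proof (rule psubset_card_mono)
        have "{\<gamma>\<in>A. lt \<gamma> \<alpha>} \<subseteq> {\<gamma>\<in>A. lt \<gamma> \<beta>}" using lt(1) that by (auto dest: transpD)
        moreover have "\<alpha> \<in> {\<gamma>\<in>A. lt \<gamma> \<beta>} - {\<gamma>\<in>A. lt \<gamma> \<alpha>}" using lt(2) that by (auto dest: irreflpD)
        ultimately show "{\<gamma>\<in>A. lt \<gamma> \<alpha>} \<subset> {\<gamma>\<in>A. lt \<gamma> \<beta>}" by blast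
      qed (use fin in simp)
      let ?\<Z> = "{Z\<in>\<Z>. eventually (\<lambda>x. x \<in> Z) (nbhd_filter p)}"
      have "\<forall>\<^sub>F i in sequentially. \<forall>Z\<in>?\<Z>. \<forall>y\<in>cball (x i) (r i). y \<in> Z"
        using fin conv by (intro eventually_ball_finite) auto
      then obtain n where n: "\<And>i. n \<le> i \<Longrightarrow> \<forall>Z\<in>?\<Z>. \<forall>y\<in>cball (x i) (r i). y \<in> Z"
        unfolding eventually_sequentially by blast
      \<comment> \<open>Independence realises the ranks as layer numbers at infinitely many
        \<open>i\<close>, hence at one beyond \<open>n\<close>, where the ball lies in all
        prescribed neighbourhoods.\<close>
      obtain i where i: "n \<le> i" and h_eq: "\<And>\<alpha>. \<alpha> \<in> A \<Longrightarrow> h \<alpha> i = rank \<alpha>"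
        using h[OF fin(1), of rank] unfolding infinite_nat_iff_unbounded_le by blast
      have rank_le: "rank \<alpha> \<le> b i" if "\<alpha> \<in> A" for \<alpha>
        using hb[of \<alpha> i] h_eq[OF that] by simp
      obtain z where z: "\<And>j. j \<le> b i \<Longrightarrow> z j \<in> F i j" "\<And>j. j < b i \<Longrightarrow> z (Suc j) \<notin> F i j"
        and spec: "\<And>j k Z. j \<le> k \<Longrightarrow> k \<le> b i \<Longrightarrow> Z \<in> \<Z> \<Longrightarrow> z k \<in> Z \<Longrightarrow> z j \<in> Z"
        by (rule specializing_sequence[where F = "F i" and n = "b i", OF fin(2) closed F0 Fclosure]) (assumption, assumption, rule that)
      have zball: "z (rank \<alpha>) \<in> cball (x i) (r i)" if "\<alpha> \<in> A" for \<alpha>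
        using z(1) Fball(1) rank_le[OF that] by blast
      have "z (rank \<alpha>) \<in> S \<alpha>" if "\<alpha> \<in> A" for \<alpha>
      proof -
        have "z (rank \<alpha>) \<in> F i (h \<alpha> i)" using z(1)[OF rank_le[OF that]] h_eq[OF that] by simp
        then show ?thesis unfolding S_def by blast
      qed
      moreover have "z (rank \<beta>) \<notin> S \<alpha>" if ab: "\<alpha> \<in> A" "\<beta> \<in> A" "lt \<alpha> \<beta>" for \<alpha> \<beta>
      proof -
        have "z (rank \<beta>) \<notin> set_option p" using zball[OF ab(2)] pnot[of i] by auto
        moreover have other: "z (rank \<beta>) \<notin> F k (h \<alpha> k)" if "k \<noteq> i" for k
          using zball[OF ab(2)] Fball(1)[OF hb[of \<alpha> k]] disj[OF that] by blast
        moreover have "z (rank \<beta>) \<notin> F i (h \<alpha> i)"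
        proof -
          \<comment> \<open>The point \<open>z (Suc m)\<close> avoids layer \<open>m\<close>, which
            contains the layer of \<alpha>; this is why strict growth of \<open>rank\<close> is
            needed.\<close>
          obtain m where m: "rank \<beta> = Suc m" "rank \<alpha> \<le> m"
            using rank[OF ab(3,1)] by (metis less_Suc_eq_le not0_implies_Suc not_less_zero)
          then show ?thesis
            using z(2)[of m] Fmono[of "rank \<alpha>" m i] rank_le[OF ab(2)] h_eq[OF ab(1)] by auto
        qed
        ultimately show ?thesis unfolding S_def using other by (metis UN_E Un_iff)
      qed
      ultimately show "\<exists>y. (\<forall>\<alpha>\<in>A. y \<alpha> \<in> S \<alpha> \<inter> (\<Union>i. cball (x i) (r i)) \<and>
            (\<forall>Z\<in>\<Z>. eventually (\<lambda>x. x \<in> Z) (nbhd_filter p) \<longrightarrow> y \<alpha> \<in> Z)) \<and>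
          (\<forall>\<alpha>\<in>A. \<forall>\<beta>\<in>A. lt \<alpha> \<beta> \<longrightarrow> y \<beta> \<notin> S \<alpha> \<and> (\<forall>Z\<in>\<Z>. y \<beta> \<in> Z \<longrightarrow> y \<alpha> \<in> Z))"
      proof (intro exI[of _ "\<lambda>\<alpha>. z (rank \<alpha>)"] conjI ballI impI IntI)
        fix \<alpha> assume \<alpha>: "\<alpha> \<in> A"
        show "z (rank \<alpha>) \<in> (\<Union>i. cball (x i) (r i))" using zball[OF \<alpha>] by blast
        show "z (rank \<alpha>) \<in> Z" if "Z \<in> \<Z>" "eventually (\<lambda>x. x \<in> Z) (nbhd_filter p)" for Z
          using n[OF i] zball[OF \<alpha>] that by blast
        show "z (rank \<alpha>) \<in> Z" if "\<beta> \<in> A" "lt \<alpha> \<beta>" "Z \<in> \<Z>" "z (rank \<beta>) \<in> Z" for \<beta> Z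
          using rank[OF that(2) \<alpha>] by (intro spec[OF _ rank_le[OF that(1)] that(3,4)]) simp
      qed
    qed
  qed (rule r)+
qed


section \<open>Prime z-ideals\<close>

lemma C0_functionsI:
  assumes "f \<in> continuous_functions" "\<And>\<epsilon>. \<epsilon> > 0 \<Longrightarrow> \<exists>K. compact K \<and> {x. \<epsilon> \<le> norm (f x)} \<subseteq> K"
  shows "f \<in> C0_functions"
proof -
  have "compact {x. \<epsilon> \<le> norm (f x)}" if \<epsilon>: "\<epsilon> > 0" for \<epsilon>
  proof -
    obtain K where K: "compact K" "{x. \<epsilon> \<le> norm (f x)} \<subseteq> K" using assms(2)[OF \<epsilon>] by blast
    have "closed {x. \<epsilon> \<le> norm (f x)}"
      using assms(1) by (intro closed_Collect_le) (auto simp: continuous_functions_def intro: continuous_intros)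
    with K show ?thesis by (metis compact_Int_closed inf.absorb2)
  qed
  with assms(1) show ?thesis by (simp add: C0_functions_def)
qed

lemma C0_functions_continuous: "f \<in> C0_functions \<Longrightarrow> f \<in> continuous_functions"
  by (simp add: C0_functions_def)

lemma C0_functions_compact: "f \<in> C0_functions \<Longrightarrow> \<epsilon> > 0 \<Longrightarrow> compact {x. \<epsilon> \<le> norm (f x)}"
  by (simp add: C0_functions_def)

lemma C0_functions_add:
  assumes "f \<in> C0_functions" "g \<in> C0_functions"
  shows "(\<lambda>x. f x + g x) \<in> C0_functions"
proof (rule C0_functionsI)
  show "(\<lambda>x. f x + g x) \<in> continuous_functions"
    using assms[THEN C0_functions_continuous] by (auto simp: continuous_functions_def intro: continuous_intros)
  fix \<epsilon> :: real assume "\<epsilon> > 0"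
  let ?K = "{x. \<epsilon> / 2 \<le> norm (f x)} \<union> {x. \<epsilon> / 2 \<le> norm (g x)}"
  have "compact ?K" using assms \<open>\<epsilon> > 0\<close> by (intro compact_Un C0_functions_compact) auto
  moreover have "{x. \<epsilon> \<le> norm (f x + g x)} \<subseteq> ?K"
  proof
    fix x assume "x \<in> {x. \<epsilon> \<le> norm (f x + g x)}"
    then show "x \<in> ?K" using norm_triangle_ineq[of "f x" "g x"] by simp linarith
  qed
  ultimately show "\<exists>K. compact K \<and> {x. \<epsilon> \<le> norm (f x + g x)} \<subseteq> K" by blast
qed

lemma C0_functions_bounded_mult:
  assumes "f \<in> C0_functions" "g \<in> continuous_functions" and M: "\<And>x. norm (g x) \<le> M"
  shows "(\<lambda>x. g x * f x) \<in> C0_functions"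
proof (rule C0_functionsI)
  show "(\<lambda>x. g x * f x) \<in> continuous_functions"
    using assms by (auto simp: continuous_functions_def C0_functions_def intro: continuous_intros)
  fix \<epsilon> :: real assume "\<epsilon> > 0"
  have M_pos: "\<bar>M\<bar> + 1 > 0" by simp
  \<comment> \<open>Adding 1 keeps the divisor positive when \<open>M\<close> is 0.\<close>
  let ?K = "{x. \<epsilon> / (\<bar>M\<bar> + 1) \<le> norm (f x)}"
  have "compact ?K" using assms \<open>\<epsilon> > 0\<close> by (intro C0_functions_compact) auto
  moreover have "{x. \<epsilon> \<le> norm (g x * f x)} \<subseteq> ?K"
  proof
    fix x assume "x \<in> {x. \<epsilon> \<le> norm (g x * f x)}"
    then have "\<epsilon> \<le> norm (g x) * norm (f x)" by (simp add: norm_mult)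
    also have "\<dots> \<le> (\<bar>M\<bar> + 1) * norm (f x)"
      using M[of x] by (intro mult_right_mono) auto
    finally show "x \<in> ?K" using M_pos by (simp add: pos_divide_le_eq mult.commute)
  qed
  ultimately show "\<exists>K. compact K \<and> {x. \<epsilon> \<le> norm (g x * f x)} \<subseteq> K" by blast
qed

lemma C0_functions_bounded:
  assumes "f \<in> C0_functions"
  obtains M where "\<And>x. norm (f x) \<le> M"
proof -
  have "compact (f ` {x. 1 \<le> norm (f x)})"
    using assms by (intro compact_continuous_image C0_functions_compact)
      (auto simp: C0_functions_def continuous_functions_def intro: continuous_on_subset)
  then obtain M where M: "\<And>y. y \<in> f ` {x. 1 \<le> norm (f x)} \<Longrightarrow> norm y \<le> M"
    using compact_imp_bounded bounded_iff by metis
  have "norm (f x) \<le> max 1 M" for x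
    using M[of "f x"] by (cases "1 \<le> norm (f x)") auto
  then show thesis by (rule that)
qed

lemma C0_functions_mult:
  assumes "f \<in> C0_functions" "g \<in> C0_functions"
  shows "(\<lambda>x. g x * f x) \<in> C0_functions"
proof -
  obtain M where "\<And>x. norm (g x) \<le> M" using C0_functions_bounded[OF assms(2)] by blast
  then show ?thesis using assms by (intro C0_functions_bounded_mult C0_functions_continuous)
qed

lemma zero_set_mult:
  fixes f g :: "'a \<Rightarrow> 'k::real_normed_field"
  shows "zero_set (\<lambda>x. g x * f x) = zero_set g \<union> zero_set f"
  by (auto simp: zero_set_def)

section \<open>Ideals attached to prime z-filters\<close>

lemma prime_z_filterD:
  assumes "prime_z_filter K P"
  shows "\<And>Y Z. Y \<in> P \<Longrightarrow> Z \<in> P \<Longrightarrow> Y \<inter> Z \<in> P"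
    and "\<And>Y Z. Y \<in> P \<Longrightarrow> Z \<in> zero_sets K \<Longrightarrow> Y \<subseteq> Z \<Longrightarrow> Z \<in> P"
    and "\<And>Y Z. Y \<in> zero_sets K \<Longrightarrow> Z \<in> zero_sets K \<Longrightarrow> Y \<union> Z \<in> P \<Longrightarrow> Y \<in> P \<or> Z \<in> P"
    and "P \<subseteq> zero_sets K" "P \<noteq> {}"
  using assms unfolding prime_z_filter_def z_filter_def by blast+

lemma inverse_zero_mem:
  assumes P: "prime_z_filter TYPE('k) P" and g: "g \<in> C0_functions"
    and "Z \<in> P" "Z \<subseteq> zero_set g"
  shows "g \<in> (C0_functions :: ('a::topological_space \<Rightarrow> 'k::real_normed_field) set) \<inter> inverse_zero P"
  using prime_z_filterD(2)[OF P \<open>Z \<in> P\<close> zero_set_mem_zero_sets[OF C0_functions_continuous[OF g]] \<open>Z \<subseteq> zero_set g\<close>] g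
  by (simp add: inverse_zero_def C0_functions_continuous)

lemma C0_ideal_inverse_zero:
  fixes P :: "'a::topological_space set set"
  assumes P: "prime_z_filter TYPE('k::real_normed_field) P"
  shows "C0_ideal ((C0_functions :: ('a \<Rightarrow> 'k) set) \<inter> inverse_zero P)" (is "C0_ideal ?I")
  unfolding C0_ideal_def
proof (intro conjI ballI allI)
  have zero: "zero_set f \<in> P" "f \<in> C0_functions" if "f \<in> ?I" for f
    using that by (auto simp: inverse_zero_def)
  show "?I \<subseteq> C0_functions" by blast
  have "(\<lambda>x. 0 :: 'k) \<in> C0_functions"
    by (rule C0_functionsI) (auto simp: continuous_functions_def intro: exI[of _ "{}"])
  moreover obtain Z where "Z \<in> P" using prime_z_filterD(5)[OF P] by blast
  ultimately show "(\<lambda>x. 0) \<in> ?I"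
    by (rule inverse_zero_mem[OF P]) (simp add: zero_set_def)
  fix f assume f: "f \<in> ?I"
  show "(\<lambda>x. f x + g x) \<in> ?I" if g: "g \<in> ?I" for g
    by (rule inverse_zero_mem[OF P C0_functions_add prime_z_filterD(1)[OF P zero(1)[OF f] zero(1)[OF g]]])
      (use zero(2)[OF f] zero(2)[OF g] in \<open>auto simp: zero_set_def\<close>)
  show "(\<lambda>x. c * f x) \<in> ?I" for c
    by (rule inverse_zero_mem[OF P C0_functions_bounded_mult zero(1)[OF f]])
      (use zero(2)[OF f] in \<open>auto simp: zero_set_def continuous_functions_def\<close>)
  show "(\<lambda>x. g x * f x) \<in> ?I" if "g \<in> C0_functions" for g
    by (rule inverse_zero_mem[OF P C0_functions_mult zero(1)[OF f]])
      (use zero(2)[OF f] that in \<open>auto simp: zero_set_def\<close>)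
qed

lemma C0_z_ideal_inverse_zero:
  fixes P :: "'a::topological_space set set"
  assumes P: "prime_z_filter TYPE('k::real_normed_field) P"
  shows "C0_z_ideal ((C0_functions :: ('a \<Rightarrow> 'k) set) \<inter> inverse_zero P)"
  unfolding C0_z_ideal_def
  using C0_ideal_inverse_zero[OF P] inverse_zero_mem[OF P] by (auto simp: inverse_zero_def)

text \<open>The function \<open>u\<close> witnesses that the ideal is proper. Properness of
  \<open>P\<close> would not suffice: on an uncountable discrete space a prime z-filter may contain
  all cocountable sets, and so the zero sets of all functions vanishing at infinity.\<close>

lemma C0_prime_ideal_inverse_zero:
  fixes P :: "'a::topological_space set set"
  assumes P: "prime_z_filter TYPE('k::real_normed_field) P"
    and u: "u \<in> (C0_functions :: ('a \<Rightarrow> 'k) set)" "zero_set u \<notin> P"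
  shows "C0_prime_ideal ((C0_functions :: ('a \<Rightarrow> 'k) set) \<inter> inverse_zero P)" (is "C0_prime_ideal ?I")
  unfolding C0_prime_ideal_def
proof (intro conjI ballI impI)
  show "C0_ideal ?I" using P by (rule C0_ideal_inverse_zero)
  show "?I \<noteq> C0_functions" using u by (auto simp: inverse_zero_def)
  fix f g :: "'a \<Rightarrow> 'k"
  assume fg: "f \<in> C0_functions" "g \<in> C0_functions" "(\<lambda>x. f x * g x) \<in> ?I"
  then have "zero_set f \<union> zero_set g \<in> P"
    by (simp add: inverse_zero_def zero_set_mult)
  then have "zero_set f \<in> P \<or> zero_set g \<in> P"
    using fg by (intro prime_z_filterD(3)[OF P] zero_set_mem_zero_sets C0_functions_continuous)
  then show "f \<in> ?I \<or> g \<in> ?I"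
    using fg by (auto simp: inverse_zero_def C0_functions_continuous)
qed

text \<open>Multiplying by a function \<open>u\<close> that vanishes on no member of the smaller filter turns a function
  separating the two filters into one that also vanishes at infinity.\<close>
lemma C0_inverse_zero_strict_mono:
  fixes P P' :: "'a::metric_space set set"
  assumes P: "prime_z_filter TYPE('k::real_normed_field) P" and P': "prime_z_filter TYPE('k) P'"
    and "P' \<subset> P" and u: "u \<in> (C0_functions :: ('a \<Rightarrow> 'k) set)" "zero_set u \<notin> P'"
  shows "(C0_functions :: ('a \<Rightarrow> 'k) set) \<inter> inverse_zero P' \<subset> C0_functions \<inter> inverse_zero P"
proof -
  obtain Z where Z: "Z \<in> P" "Z \<notin> P'" using \<open>P' \<subset> P\<close> by blast
  then have "closed Z" using prime_z_filterD(4)[OF P] by (auto simp: zero_sets_eq_closed)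
  let ?g = "\<lambda>x. separator Z x * u x"
  have g: "?g \<in> C0_functions"
    by (rule C0_functions_bounded_mult[OF u(1) continuous_separator norm_separator_le_1])
  have zero: "zero_set ?g = Z \<union> zero_set u"
    by (simp add: zero_set_mult zero_set_separator \<open>closed Z\<close>)
  have "?g \<in> C0_functions \<inter> inverse_zero P"
    by (rule inverse_zero_mem[OF P g Z(1)]) (simp add: zero)
  moreover have "?g \<notin> inverse_zero P'"
  proof
    assume "?g \<in> inverse_zero P'"
    then have "Z \<union> zero_set u \<in> P'" by (simp add: inverse_zero_def zero)
    then have "Z \<in> P' \<or> zero_set u \<in> P'"
      using \<open>closed Z\<close> u(1) prime_z_filterD(4)[OF P] Z
      by (intro prime_z_filterD(3)[OF P'] zero_set_mem_zero_sets C0_functions_continuous) auto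
    with Z u show False by blast
  qed
  moreover have "C0_functions \<inter> inverse_zero P' \<subseteq> C0_functions \<inter> inverse_zero P"
    using \<open>P' \<subset> P\<close> by (auto simp: inverse_zero_def)
  ultimately show ?thesis by blast
qed

section \<open>Supports of the filters and ideals\<close>

text \<open>At a finite point, a closed member missing \<open>q\<close> would be disjoint from a
  small closed ball, itself a member. At infinity, the complement of a small open ball around any
  \<open>x\<close> is a member that excludes \<open>x\<close>.\<close>

lemma filter_supported_at_nbhd_filter:
  fixes p :: "'a::metric_space option"
  assumes lc: "locally_compact_space (euclidean :: 'a topology)"
    and P: "prime_z_filter TYPE('k::real_normed_field) P" "{} \<notin> P"
    and nbhd: "\<And>Z. closed Z \<Longrightarrow> eventually (\<lambda>x. x \<in> Z) (nbhd_filter p) \<Longrightarrow> Z \<in> P"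
  shows "filter_supported_at P p"
proof (cases p)
  case (Some q)
  have "q \<in> Z" if "Z \<in> P" for Z
  proof (rule ccontr)
    assume "q \<notin> Z"
    have "closed Z" using that prime_z_filterD(4)[OF P(1)] by (auto simp: zero_sets_eq_closed)
    then obtain e where e: "e > 0" "cball q e \<subseteq> - Z"
      using \<open>q \<notin> Z\<close> by (metis ComplI open_Compl open_contains_cball)
    have "cball q e \<in> P"
      using e(1) Some by (intro nbhd) (auto simp: eventually_nhds_metric dist_commute intro: less_imp_le)
    then have "Z \<inter> cball q e \<in> P" using prime_z_filterD(1)[OF P(1) that] by blast
    moreover have "Z \<inter> cball q e = {}" using e(2) by blast
    ultimately show False using P(2) by simp
  qed
  with Some show ?thesis by (simp add: filter_supported_at_def)
next
  case None
  have "\<exists>Z\<in>P. x \<notin> Z" for x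
  proof -
    obtain e where e: "e > 0" "compact (cball x e)" using compact_cball_exists[OF lc] .
    have "- ball x e \<in> P"
    proof (rule nbhd)
      show "eventually (\<lambda>y. y \<in> - ball x e) (nbhd_filter p)"
        unfolding None eventually_nbhd_filter_None
        by (rule exI[of _ "cball x e"]) (use e in auto)
    qed (simp add: closed_Compl)
    with e show ?thesis by (intro bexI[of _ "- ball x e"]) auto
  qed
  with None show ?thesis by (auto simp: filter_supported_at_def)
qed

lemma ideal_supported_at_inverse_zero:
  fixes P :: "'a::metric_space set set"
  assumes lc: "locally_compact_space (euclidean :: 'a topology)"
    and P: "prime_z_filter TYPE('k::real_normed_field) P" "filter_supported_at P p"
  shows "ideal_supported_at ((C0_functions :: ('a \<Rightarrow> 'k) set) \<inter> inverse_zero P) p"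
proof (cases p)
  case (Some q)
  then have "\<And>Z. Z \<in> P \<Longrightarrow> q \<in> Z" using P(2) by (simp add: filter_supported_at_def)
  then have "f q = 0" if "f \<in> inverse_zero P" for f :: "'a \<Rightarrow> 'k"
    using that by (fastforce simp: inverse_zero_def zero_set_def)
  with Some show ?thesis by (simp add: ideal_supported_at_def)
next
  case None
  have "\<exists>f\<in>(C0_functions :: ('a \<Rightarrow> 'k) set) \<inter> inverse_zero P. f x \<noteq> 0" for x
  proof -
    obtain Z where Z: "Z \<in> P" "x \<notin> Z" using P(2) None by (auto simp: filter_supported_at_def)
    then have "open (- Z)" "x \<in> - Z"
      using prime_z_filterD(4)[OF P(1)] by (auto simp: zero_sets_eq_closed)
    then obtain e where e: "e > 0" "cball x e \<subseteq> - Z" by (meson open_contains_cball)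
    obtain d where d: "d > 0" "compact (cball x d)" using compact_cball_exists[OF lc] .
    \<comment> \<open>A tent at \<open>x\<close>: radius at most \<open>d\<close> confines it to a
      compact ball, and radius at most \<open>e\<close> makes it vanish on \<open>Z\<close>.\<close>
    define f :: "'a \<Rightarrow> 'k" where "f y = of_real (max 0 (min d e - dist x y))" for y
    have f: "f \<in> C0_functions"
    proof (rule C0_functionsI)
      show "f \<in> continuous_functions"
        unfolding continuous_functions_def f_def by (auto intro!: continuous_intros)
      show "\<exists>K. compact K \<and> {y. \<epsilon> \<le> norm (f y)} \<subseteq> K" if "\<epsilon> > 0" for \<epsilon>
        using d(2) that by (intro exI[of _ "cball x d"]) (auto simp: f_def)
    qed
    have "Z \<subseteq> zero_set f"
    proof
      fix y assume "y \<in> Z"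
      then have "y \<notin> cball x e" using e(2) by blast
      then show "y \<in> zero_set f" by (simp add: zero_set_def f_def)
    qed
    then have "f \<in> C0_functions \<inter> inverse_zero P"
      by (rule inverse_zero_mem[OF P(1) f Z(1)])
    moreover have "f x \<noteq> 0" using d e by (simp add: f_def)
    ultimately show ?thesis by blast
  qed
  with None show ?thesis by (auto simp: ideal_supported_at_def)
qed

text \<open>Adds up weighted tents over the balls. The geometric weights give uniform convergence,
  and each partial sum vanishes off a finite union of compact balls, so the limit vanishes at
  infinity.\<close>

lemma C0_function_nonzero_on_balls:
  fixes x :: "nat \<Rightarrow> 'a::metric_space"
  assumes r: "\<And>i. r i > 0" "\<And>i. r i \<le> 1" and compact: "\<And>i. compact (cball (x i) (2 * r i))"
  obtains u :: "'a \<Rightarrow> 'k::real_normed_field" where "u \<in> C0_functions"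
    "zero_set u \<inter> (\<Union>i. cball (x i) (r i)) = {}"
proof -
  \<comment> \<open>Twice the radius makes the tent positive on the whole closed ball of radius
    \<open>r i\<close>, boundary included.\<close>
  define c where "c i y = (1 / 2) ^ i * max 0 (2 * r i - dist (x i) y)" for i y
  have c_nonneg: "c i y \<ge> 0" for i y by (simp add: c_def)
  have c_le: "c i y \<le> 2 * (1 / 2) ^ i" for i y
  proof -
    have "max 0 (2 * r i - dist (x i) y) \<le> 2" using r(2)[of i] zero_le_dist[of "x i" y] by (intro max.boundedI) linarith+
    then show ?thesis unfolding c_def by (simp add: mult.commute)
  qed
  have summ: "summable (\<lambda>i. 2 * (1 / 2 :: real) ^ i)" by (intro summable_mult summable_geometric) simp
  have c_sum: "summable (\<lambda>i. c i y)" for y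
    by (rule summable_comparison_test[OF _ summ]) (use c_nonneg c_le in auto)
  define s where "s y = (\<Sum>i. c i y)" for y
  have unif: "uniform_limit UNIV (\<lambda>n y. \<Sum>i<n. c i y) s sequentially"
    unfolding s_def by (rule Weierstrass_m_test[OF _ summ]) (use c_nonneg c_le in auto)
  have "continuous_on UNIV s"
    by (rule uniform_limit_theorem[OF _ unif])
      (auto simp: c_def intro!: always_eventually continuous_intros)
  have s_pos: "s y > 0" if "y \<in> cball (x i) (r i)" for i y
  proof -
    have "c i y > 0" using that r(1)[of i] by (simp add: c_def)
    also have "c i y \<le> s y"
      unfolding s_def using sum_le_suminf[OF c_sum, of "{i}" y] c_nonneg by simp
    finally show ?thesis .
  qed
  have s_nonneg: "s y \<ge> 0" for y unfolding s_def using c_sum c_nonneg by (rule suminf_nonneg)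
  have "(\<lambda>y. of_real (s y) :: 'k) \<in> C0_functions"
  proof (rule C0_functionsI)
    show "(\<lambda>y. of_real (s y) :: 'k) \<in> continuous_functions"
      using \<open>continuous_on UNIV s\<close> by (auto simp: continuous_functions_def intro: continuous_intros)
    fix \<epsilon> :: real assume "\<epsilon> > 0"
    then have "\<forall>\<^sub>F n in sequentially. \<forall>y\<in>UNIV. dist (\<Sum>i<n. c i y) (s y) < \<epsilon>"
      by (rule uniform_limitD[OF unif])
    then obtain n where n: "\<And>y. dist (\<Sum>i<n. c i y) (s y) < \<epsilon>"
      by (auto simp: eventually_sequentially)
    let ?K = "\<Union>i<n. cball (x i) (2 * r i)"
    have "y \<in> ?K" if "\<epsilon> \<le> s y" for y
    proof (rule ccontr)
      assume "y \<notin> ?K"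
      then have "c i y = 0" if "i < n" for i
        using that by (fastforce simp: c_def max_def)
      then have "(\<Sum>i<n. c i y) = 0" by simp
      with n[of y] that show False by (simp add: dist_real_def)
    qed
    then have "{y. \<epsilon> \<le> norm (of_real (s y) :: 'k)} \<subseteq> ?K"
      using s_nonneg by auto
    moreover have "compact ?K" using compact by (intro compact_UN) auto
    ultimately show "\<exists>K. compact K \<and> {y. \<epsilon> \<le> norm (of_real (s y) :: 'k)} \<subseteq> K" by blast
  qed
  moreover have "zero_set (\<lambda>y. of_real (s y) :: 'k) \<inter> (\<Union>i. cball (x i) (r i)) = {}"
    using s_pos by (force simp: zero_set_def)
  ultimately show thesis by (rule that)
qed

theorem theorem4p2:
  fixes p :: "'a::metric_space option"
  assumes "locally_compact_space (euclidean :: 'a topology)"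
    and "p \<in> limit_points_infinity (Alexandroff_compactification (euclidean :: 'a topology))"
  shows "\<exists>\<Q> :: (nat \<Rightarrow> bool) \<Rightarrow> 'a set set.
           decreasing_chain continuum \<Q> \<and>
           (\<forall>\<alpha>\<in>Field continuum.
              prime_z_filter TYPE('k::{real_normed_field, euclidean_space}) (\<Q> \<alpha>) \<and>
              filter_supported_at (\<Q> \<alpha>) p) \<and>
           (let Q = (\<lambda>\<alpha>. (C0_functions :: ('a \<Rightarrow> 'k) set) \<inter> inverse_zero (\<Q> \<alpha>)) in
              decreasing_chain continuum Q \<and>
              (\<forall>\<alpha>\<in>Field continuum.
                 C0_prime_ideal (Q \<alpha>) \<and> C0_z_ideal (Q \<alpha>) \<and> ideal_supported_at (Q \<alpha>) p))"
proof -
  have wo: "Well_order continuum" unfolding continuum_def by (rule card_of_Well_order)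
  then have "trans continuum" "antisym continuum"
    by (auto simp: well_order_on_def linear_order_on_def partial_order_on_def preorder_on_def)
  define lt where "lt \<alpha> \<beta> \<longleftrightarrow> (\<alpha>, \<beta>) \<in> continuum \<and> \<alpha> \<noteq> \<beta>" for \<alpha> \<beta>
  have lt: "transp lt" "irreflp lt"
    using \<open>trans continuum\<close> \<open>antisym continuum\<close>
    unfolding lt_def transp_def irreflp_def by (blast dest: transD antisymD)+
  obtain x r S where r: "\<And>i :: nat. r i > (0 :: real)" "\<And>i. r i \<le> 1" "\<And>i. compact (cball (x i) (2 * r i))"
    and S: "\<And>\<alpha>. closed (S \<alpha>)" "finitely_separated (nbhd_filter p) lt S (\<Union>i. cball (x i) (r i))"
    by (rule separated_points[OF assms lt]) (rule that)
  let ?B = "\<Union>i. cball (x i) (r i)"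
  obtain P :: "(nat \<Rightarrow> bool) \<Rightarrow> 'a set set" where P: "\<And>\<alpha>. prime_z_filter TYPE('k) (P \<alpha>)"
    and nbhd: "\<And>\<alpha> Z. closed Z \<Longrightarrow> eventually (\<lambda>x. x \<in> Z) (nbhd_filter p) \<Longrightarrow> Z \<in> P \<alpha>"
    and B: "\<And>\<alpha> Z. Z \<in> P \<alpha> \<Longrightarrow> Z \<inter> ?B \<noteq> {}"
    and chain: "\<And>\<alpha> \<beta>. lt \<alpha> \<beta> \<Longrightarrow> P \<beta> \<subset> P \<alpha>"
    by (rule prime_z_filter_chain[OF S(2,1)]) (rule that)
  \<comment> \<open>Every member of every filter meets \<open>?B\<close>, so this single
    \<open>u\<close> serves all indices: it makes each ideal proper and keeps the inclusions
    strict.\<close>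
  obtain u :: "'a \<Rightarrow> 'k" where u: "u \<in> C0_functions" "zero_set u \<inter> ?B = {}"
    by (rule C0_function_nonzero_on_balls[OF r]) (rule that)
  have u_notin: "zero_set u \<notin> P \<alpha>" for \<alpha> using B[of "zero_set u" \<alpha>] u(2) by blast
  have supp: "filter_supported_at (P \<alpha>) p" for \<alpha>
    by (rule filter_supported_at_nbhd_filter[OF assms(1) P _ nbhd]) (use B[of "{}"] in auto)
  show ?thesis
  proof (unfold Let_def, intro exI[of _ P] conjI)
    show "decreasing_chain continuum P"
      using wo chain by (simp add: decreasing_chain_def lt_def)
    show "decreasing_chain continuum (\<lambda>\<alpha>. (C0_functions :: ('a \<Rightarrow> 'k) set) \<inter> inverse_zero (P \<alpha>))"
      unfolding decreasing_chain_def
      using wo C0_inverse_zero_strict_mono[OF P P chain u(1) u_notin] by (simp add: lt_def)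
  qed (use P supp C0_prime_ideal_inverse_zero[OF P u(1) u_notin] C0_z_ideal_inverse_zero[OF P]
        ideal_supported_at_inverse_zero[OF assms(1) P supp] in blast)+
qed

end
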